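(* Let $R$ be an integer with $|R|\ge2$ and $B=\{0,b\}$ with $b\in\mathbb{Z}$, $b\ne0$. Let $L\subset\mathbb{Z}$ be finite with $0\in L$ and $(\alpha_l)_{l\in L}$ nonzero complex numbers with $\alpha_0=1$. The matrix $\frac{1}{\sqrt2}\left(e^{2\pi i lc/R}\alpha_l\right)_{l\in L,c\in B}$ has orthonormal columns if and only if the following four conditions hold: (i) $R=2^\alpha r$ with $\alpha\in\mathbb{N}$ ($\alpha\ge1$) and $r$ odd; (ii) $b=2^\beta q$ with $\beta\in\mathbb{N}\cup\{0\}$, $\beta\le\alpha-1$, and $q$ odd; (iii) every $l\in L\setminus\{0\}$ is of the form $l=2^{\alpha-1-\beta}s$ with $s$ odd and $qs$ divisible by $r$; (iv) $\sum_{l\in L\setminus\{0\}}|\alpha_l|^2=1$. If in addition (v) there exist $l_1,l_2\in L\setminus\{0\}$ with $l_1\not\equiv l_2\pmod R$, then $\left\{\Big(\prod_{j=0}^k\alpha_{l_j}\Big)e_{l_0+Rl_1+\dots+R^kl_k}: l_0\dots l_k\in\Omega(L)\right\}$ is a Parseval frame for $L^2(\mu(R,B))$.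
   Context: $\mu(R,B)$ is the unique Borel probability measure on $\mathbb{R}$ with $\mu(E)=\frac12(\mu(\tau_0^{-1}E)+\mu(\tau_b^{-1}E))$, $\tau_c(x)=(x+c)/R$. $e_\lambda(x)=e^{2\pi i\lambda x}$. $\Omega(L)$: the empty word (giving $e_0$ with weight 1) and all words $l_0\dots l_k$ with $l_i\in L$, $l_k\ne0$. Parseval frame: $\sum_i|\langle v,f_i\rangle|^2=\|v\|^2$ for all $v$. *)

theory Defs
  imports "HOL-Probability.Probability"
begin

definition tau :: "int \<Rightarrow> int \<Rightarrow> real \<Rightarrow> real" where
  "tau R c x = (x + real_of_int c) / real_of_int R"

text \<open>M is the invariant measure mu(R,B) for B = {0,b}: a Borel probability measure on the reals
  satisfying mu(E) = 1/2 (mu(tau_0^-1 E) + mu(tau_b^-1 E)) for all Borel E.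
  (Such a measure is unique, so assuming this property identifies mu(R,B).)\<close>
definition is_mu :: "int \<Rightarrow> int \<Rightarrow> real measure \<Rightarrow> bool" where
  "is_mu R b M \<longleftrightarrow> sets M = sets borel \<and> prob_space M \<and>
     (\<forall>E\<in>sets borel. measure M E =
        (measure M (tau R 0 -` E) + measure M (tau R b -` E)) / 2)"

definition expo :: "real \<Rightarrow> real \<Rightarrow> complex" where
  "expo lam x = exp (2 * complex_of_real pi * \<i> * complex_of_real (lam * x))"

definition Omega :: "int set \<Rightarrow> int list set" where
  "Omega L = {ws. ws = [] \<or> (set ws \<subseteq> L \<and> last ws \<noteq> 0)}"

definition word_freq :: "int \<Rightarrow> int list \<Rightarrow> int" where
  "word_freq R ws = (\<Sum>j<length ws. ws ! j * R ^ j)"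

definition word_weight :: "(int \<Rightarrow> complex) \<Rightarrow> int list \<Rightarrow> complex" where
  "word_weight a ws = (\<Prod>j<length ws. a (ws ! j))"

definition L2_inner :: "real measure \<Rightarrow> (real \<Rightarrow> complex) \<Rightarrow> (real \<Rightarrow> complex) \<Rightarrow> complex" where
  "L2_inner M f g = (LINT x|M. f x * cnj (g x))"

definition in_L2 :: "real measure \<Rightarrow> (real \<Rightarrow> complex) \<Rightarrow> bool" where
  "in_L2 M f \<longleftrightarrow> f \<in> borel_measurable M \<and> integrable M (\<lambda>x. (cmod (f x))\<^sup>2)"

definition parseval_frame :: "real measure \<Rightarrow> 'i set \<Rightarrow> ('i \<Rightarrow> real \<Rightarrow> complex) \<Rightarrow> bool" where
  "parseval_frame M I g \<longleftrightarrow> (\<forall>f. in_L2 M f \<longrightarrow>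
      ((\<lambda>i. (cmod (L2_inner M f (g i)))\<^sup>2) has_sum (LINT x|M. (cmod (f x))\<^sup>2)) I)"

definition ortho_columns :: "int \<Rightarrow> int set \<Rightarrow> int set \<Rightarrow> (int \<Rightarrow> complex) \<Rightarrow> bool" where
  "ortho_columns R B L a \<longleftrightarrow> (\<forall>c\<in>B. \<forall>c'\<in>B.
     (\<Sum>l\<in>L. (expo (real_of_int l * real_of_int c / real_of_int R) 1 * a l / sqrt 2) *
               cnj (expo (real_of_int l * real_of_int c' / real_of_int R) 1 * a l / sqrt 2))
     = (if c = c' then 1 else 0))"

definition conds_i_iv :: "int \<Rightarrow> int \<Rightarrow> int set \<Rightarrow> (int \<Rightarrow> complex) \<Rightarrow> bool" where
  "conds_i_iv R b L a \<longleftrightarrow>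
     (\<exists>(\<alpha>::nat) (r::int) (\<beta>::nat) (q::int).
        \<alpha> \<ge> 1 \<and> odd r \<and> R = 2 ^ \<alpha> * r \<and>
        \<beta> \<le> \<alpha> - 1 \<and> odd q \<and> b = 2 ^ \<beta> * q \<and>
        (\<forall>l\<in>L - {0}. \<exists>s::int. l = 2 ^ (\<alpha> - 1 - \<beta>) * s \<and> odd s \<and> r dvd q * s) \<and>
        (\<Sum>l\<in>L - {0}. (cmod (a l))\<^sup>2) = 1)"

end

theory Submission
  imports Defs
begin

text \<open>
  Orthonormality of the columns says that \<open>\<Sum>\<^sub>l |\<alpha>\<^sub>l|\<^sup>2 = 2\<close> and
  \<open>\<Sum>\<^sub>l |\<alpha>\<^sub>l|\<^sup>2 exp(2\<pi>i l b/R) = 0\<close>. Since \<open>l = 0\<close> contributes \<open>1\<close>, every other exponential must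
  be \<open>-1\<close>, that is \<open>2 l b = R m\<close> with \<open>m\<close> odd; comparing powers of \<open>2\<close> gives (i)--(iii).

  For the frame, let \<open>T\<^sub>l f(y) = (cnj \<alpha>\<^sub>l / 2) \<Sum>\<^sub>c cnj(e\<^sub>l(\<tau>\<^sub>c y)) f(\<tau>\<^sub>c y)\<close>. Then
  \<open>\<Sum>\<^sub>l \<parallel>T\<^sub>l f\<parallel>\<^sup>2 = \<parallel>f\<parallel>\<^sup>2\<close> and the coefficient of \<open>f\<close> at the word \<open>l # w\<close> is that of \<open>T\<^sub>l f\<close> at \<open>w\<close>.
  Hence the words of length at most \<open>n\<close> leave a defect \<open>D\<^sub>n f \<ge> 0\<close>, a quadratic form decreasing
  in \<open>n\<close>, and the functions with \<open>D\<^sub>n f \<longlonglongrightarrow> 0\<close> form a closed subspace of \<open>L\<^sup>2\<close>. The measure has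
  bounded support, so trigonometric polynomials are dense and it is enough to treat \<open>e\<^sub>t\<close>. There
  \<open>d(t) = lim D\<^sub>n e\<^sub>t\<close> is upper semicontinuous, \<open>d(0) = 0\<close>, and
  \<open>d(t) = cos\<^sup>2(\<pi>bt/R) d(t/R) + sin\<^sup>2(\<pi>bt/R) \<Sum>\<^sub>l\<^sub>\<noteq>\<^sub>0 |\<alpha>\<^sub>l|\<^sup>2 d((t-l)/R)\<close>.

  Suppose the maximum of \<open>d\<close> on a large interval is positive. The set of maximisers is closed under
  each step of positive weight. If the cosine never vanished along \<open>t, t/R, t/R\<^sup>2, \<dots>\<close>, semicontinuity
  would give \<open>d(0) > 0\<close>; so it vanishes at some \<open>t\<^sub>1\<close>, and all \<open>(t\<^sub>1-l)/R\<close> with \<open>l \<noteq> 0\<close> are maximisers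
  that become integers after multiplication by \<open>b\<close>. Following such a path for long, every maximiser
  becomes an integer after multiplication by a fixed \<open>c\<close> coprime to \<open>R\<close>. Applied to
  \<open>(t\<^sub>1-l\<^sub>1)/R\<close> and \<open>(t\<^sub>1-l\<^sub>2)/R\<close> this forces \<open>R\<close> to divide \<open>l\<^sub>1 - l\<^sub>2\<close>, contradicting (v).
\<close>

section \<open>Exponentials and words\<close>

lemma expo_eq_cis: "expo t x = cis (2 * pi * t * x)"
  by (simp add: expo_def cis_conv_exp mult_ac)

lemma norm_expo [simp]: "cmod (expo t x) = 1"
  by (simp add: expo_eq_cis)

lemma cnj_expo: "cnj (expo t x) = expo (- t) x"
  by (simp add: expo_eq_cis cis_cnj)

lemma expo_add: "expo (s + t) x = expo s x * expo t x"
  by (simp add: expo_eq_cis cis_mult algebra_simps)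

lemma expo_0 [simp]: "expo 0 x = 1"
  by (simp add: expo_eq_cis)

lemma expo_eq_1_if_Ints:
  assumes "t * x \<in> \<int>"
  shows "expo t x = 1"
proof -
  obtain k :: int where "t * x = of_int k" using assms by (auto elim: Ints_cases)
  then have "2 * pi * t * x = 2 * pi * of_int k" by (simp add: mult.assoc)
  then show ?thesis unfolding expo_eq_cis by (simp only:) (simp add: cis_multiple_2pi)
qed

lemma continuous_on_expo [continuous_intros]: "continuous_on A (expo t)"
  unfolding expo_def by (intro continuous_intros)

lemma borel_measurable_expo [measurable]: "expo t \<in> borel_measurable borel"
  by (intro borel_measurable_continuous_onI continuous_on_expo)

lemma word_freq_Nil [simp]: "word_freq R [] = 0"
  by (simp add: word_freq_def)

lemma word_freq_Cons [simp]: "word_freq R (l # ws) = l + R * word_freq R ws"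
  unfolding word_freq_def length_Cons sum.lessThan_Suc_shift
  by (simp add: sum_distrib_left mult_ac)

lemma word_weight_Nil [simp]: "word_weight a [] = 1"
  by (simp add: word_weight_def)

lemma word_weight_Cons [simp]: "word_weight a (l # ws) = a l * word_weight a ws"
  unfolding word_weight_def length_Cons prod.lessThan_Suc_shift by simp

lemma word_freq_append_zero: "word_freq R (ws @ [0]) = word_freq R ws"
  by (induction ws) auto

lemma word_weight_append_zero: "a 0 = 1 \<Longrightarrow> word_weight a (ws @ [0]) = word_weight a ws"
  by (induction ws) auto

section \<open>The orthonormality criterion\<close>

text \<open>Stands in for (i)-(iii) once a nonzero letter exists: \<open>l * b / R\<close> is half
  of an odd integer, so the exponential of frequency l takes the value -1 at
  \<open>b / R\<close>.\<close>

definition half_odd_freqs :: "int \<Rightarrow> int \<Rightarrow> int set \<Rightarrow> bool" where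
  "half_odd_freqs R b L \<longleftrightarrow> (\<forall>l\<in>L - {0}. \<exists>m. odd m \<and> 2 * l * b = R * m)"

lemma int_odd_part:
  fixes n :: int
  assumes "n \<noteq> 0"
  obtains k m where "n = 2 ^ k * m" "odd m"
proof -
  have "\<not> is_unit (2::int)" by simp
  then obtain m where "n = 2 ^ multiplicity 2 n * m" "\<not> 2 dvd m"
    using multiplicity_decompose'[OF assms] by metis
  then show ?thesis using that by blast
qed

lemma two_power_odd_eq:
  fixes x y :: int
  assumes "2 ^ i * x = 2 ^ j * y" "odd x" "odd y"
  shows "i = j \<and> x = y"
proof -
  have False if "2 ^ i' * x' = 2 ^ j' * y'" "odd x'" "i' < j'" for i' j' and x' y' :: int
  proof -
    obtain k where k: "j' = i' + Suc k" using \<open>i' < j'\<close> less_imp_Suc_add by auto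
    have "x' = 2 ^ Suc k * y'" using that(1) unfolding k power_add by simp
    then show False using that(2) by simp
  qed
  from this[of i x j y] this[of j y i x] assms have "i = j" by (cases i j rule: linorder_cases) auto
  then show ?thesis using assms by simp
qed

text \<open>In \<open>2 * l * b = R * m\<close> compare exponents of 2 and odd parts: if l has
  exponent k and odd part s, this gives \<open>Suc k + \<beta> = \<alpha>\<close> and
  \<open>q * s = r * m\<close>.\<close>

lemma conds_i_iv_iff:
  assumes "R \<noteq> 0" "b \<noteq> 0"
  shows "conds_i_iv R b L a \<longleftrightarrow> half_odd_freqs R b L \<and> (\<Sum>l\<in>L - {0}. (cmod (a l))\<^sup>2) = 1"
proof
  assume "conds_i_iv R b L a"
  then obtain \<alpha> r \<beta> q where c: "\<alpha> \<ge> 1" "odd r" "R = 2 ^ \<alpha> * r" "\<beta> \<le> \<alpha> - 1" "odd q" "b = 2 ^ \<beta> * q"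
    "\<forall>l\<in>L - {0}. \<exists>s::int. l = 2 ^ (\<alpha> - 1 - \<beta>) * s \<and> odd s \<and> r dvd q * s"
    "(\<Sum>l\<in>L - {0}. (cmod (a l))\<^sup>2) = 1"
    unfolding conds_i_iv_def by blast
  have "\<exists>m. odd m \<and> 2 * l * b = R * m" if l: "l \<in> L - {0}" for l
  proof -
    obtain s :: int where s: "l = 2 ^ (\<alpha> - 1 - \<beta>) * s" "odd s" "r dvd q * s" using c(7) l by blast
    then obtain m where m: "q * s = r * m" by (auto elim: dvdE)
    have "odd m" using m s(2) c(5) by (metis even_mult_iff)
    have "Suc (\<alpha> - 1 - \<beta> + \<beta>) = \<alpha>" using c(1,4) by simp
    then have "(2::int) ^ \<alpha> = 2 ^ Suc (\<alpha> - 1 - \<beta> + \<beta>)" by (simp only:)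
    then have "(2::int) ^ \<alpha> = 2 * 2 ^ (\<alpha> - 1 - \<beta>) * 2 ^ \<beta>" by (simp only: power_Suc power_add mult.assoc)
    then have "2 * l * b = 2 ^ \<alpha> * (q * s)" unfolding s(1) c(6) by simp
    also have "\<dots> = R * m" unfolding m c(3) by simp
    finally show ?thesis using \<open>odd m\<close> by blast
  qed
  then show "half_odd_freqs R b L \<and> (\<Sum>l\<in>L - {0}. (cmod (a l))\<^sup>2) = 1"
    using c(8) by (simp only: half_odd_freqs_def) blast
next
  assume h: "half_odd_freqs R b L \<and> (\<Sum>l\<in>L - {0}. (cmod (a l))\<^sup>2) = 1"
  obtain \<alpha> r where r: "R = 2 ^ \<alpha> * r" "odd r" using int_odd_part[OF \<open>R \<noteq> 0\<close>] by metis
  obtain \<beta> q where q: "b = 2 ^ \<beta> * q" "odd q" using int_odd_part[OF \<open>b \<noteq> 0\<close>] by metis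
  have key: "\<exists>s. l = 2 ^ (\<alpha> - 1 - \<beta>) * s \<and> odd s \<and> r dvd q * s \<and> \<alpha> \<ge> 1 \<and> \<beta> \<le> \<alpha> - 1"
    if l: "l \<in> L - {0}" for l
  proof -
    obtain m where m: "odd m" "2 * l * b = R * m" using h l unfolding half_odd_freqs_def by blast
    obtain k s where s: "l = 2 ^ k * s" "odd s" using l int_odd_part[of l] by auto
    have "2 ^ (Suc k + \<beta>) * (q * s) = 2 ^ \<alpha> * (r * m)"
      using m(2) unfolding r q s by (simp add: power_add mult_ac)
    moreover have "odd (q * s)" "odd (r * m)" using q s m r by auto
    ultimately have *: "Suc k + \<beta> = \<alpha> \<and> q * s = r * m" by (rule two_power_odd_eq)
    then have "k = \<alpha> - 1 - \<beta>" "\<alpha> \<ge> 1" "\<beta> \<le> \<alpha> - 1" by auto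
    moreover have "r dvd q * s" using * by simp
    ultimately show ?thesis using s(1,2) by (intro exI[of _ s]) simp
  qed
  \<comment> \<open>The bounds on \<open>\<alpha>\<close> and \<open>\<beta>\<close> mention no
    letter. They are read off from one nonzero letter, which exists because the weights sum to
    1.\<close>
  have "L - {0} \<noteq> {}" using h by force
  then obtain l where "l \<in> L - {0}" by blast
  from key[OF this] have ge: "\<alpha> \<ge> 1" "\<beta> \<le> \<alpha> - 1" by blast+
  have "\<forall>l\<in>L - {0}. \<exists>s::int. l = 2 ^ (\<alpha> - 1 - \<beta>) * s \<and> odd s \<and> r dvd q * s"
    using key by blast
  with ge r q h[THEN conjunct2] show "conds_i_iv R b L a" unfolding conds_i_iv_def
    by (rule_tac x = \<alpha> in exI, rule_tac x = r in exI, rule_tac x = \<beta> in exI, rule_tac x = q in exI)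
      (intro conjI; assumption)
qed

lemma expo_half_odd:
  assumes "R \<noteq> 0" "odd m" "2 * l * b = R * m"
  shows "expo (real_of_int l * real_of_int b / real_of_int R) 1 = -1"
proof -
  have "2 * real_of_int l * b = real_of_int R * m" using assms(3) by (metis of_int_mult of_int_numeral)
  then have "2 * pi * (real_of_int l * real_of_int b / real_of_int R) * 1 = real_of_int m * pi"
    using assms(1) by (simp add: field_simps)
  moreover obtain k where "m = 2 * k + 1" using assms(2) by (auto elim: oddE)
  ultimately show ?thesis
    unfolding expo_eq_cis
    using cis_multiple_2pi[of "of_int k"] cis_mult[of "2 * pi * of_int k" pi]
    by (simp add: algebra_simps)
qed

text \<open>Both diagonal entries of the Gram matrix agree because exponentials are unimodular, and
  the off-diagonal ones are conjugate. One real and one complex equation remain, in which the letter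
  0 contributes 1.\<close>

lemma ortho_columns_iff:
  fixes R b :: int and z :: "int \<Rightarrow> complex"
  assumes "b \<noteq> 0" "finite L" "0 \<in> L" "a 0 = 1"
  defines "z \<equiv> (\<lambda>l. expo (real_of_int l * real_of_int b / real_of_int R) 1 :: complex)"
  shows "ortho_columns R {0, b} L a \<longleftrightarrow>
    (\<Sum>l\<in>L - {0}. (cmod (a l))\<^sup>2) = 1 \<and> (\<Sum>l\<in>L - {0}. complex_of_real ((cmod (a l))\<^sup>2) * z l) = -1"
proof -
  have s2: "complex_of_real (sqrt 2) * complex_of_real (sqrt 2) = 2"
    by (metis of_real_mult of_real_numeral real_sqrt_mult_self abs_numeral)
  have n: "x * cnj x = complex_of_real ((cmod x)\<^sup>2)" for x by (rule complex_norm_square[symmetric])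
  have summand: "(u * a l / sqrt 2) * cnj (v * a l / sqrt 2) = complex_of_real ((cmod (a l))\<^sup>2) * (u * cnj v) / 2"
    for u v l
  proof -
    have "(u * a l / sqrt 2) * cnj (v * a l / sqrt 2)
      = (a l * cnj (a l)) * (u * cnj v) / (complex_of_real (sqrt 2) * complex_of_real (sqrt 2))"
      by (simp add: mult_ac)
    then show ?thesis unfolding s2 n by simp
  qed
  have split: "(\<Sum>l\<in>L. complex_of_real ((cmod (a l))\<^sup>2) * f l / 2)
      = (f 0 + (\<Sum>l\<in>L - {0}. complex_of_real ((cmod (a l))\<^sup>2) * f l)) / 2"
    for f :: "int \<Rightarrow> complex"
    using assms(2,3,4) by (simp add: sum.remove[of L 0] sum_divide_distrib add_divide_distrib)
  have "ortho_columns R {0, b} L a \<longleftrightarrow>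
     (\<Sum>l\<in>L. complex_of_real ((cmod (a l))\<^sup>2) * (1::complex) / 2) = 1 \<and>
     (\<Sum>l\<in>L. complex_of_real ((cmod (a l))\<^sup>2) * cnj (z l) / 2) = 0 \<and>
     (\<Sum>l\<in>L. complex_of_real ((cmod (a l))\<^sup>2) * z l / 2) = 0"
    using \<open>b \<noteq> 0\<close> unfolding ortho_columns_def summand z_def by (auto simp: n simp del: of_real_power)
  also have "(\<Sum>l\<in>L. complex_of_real ((cmod (a l))\<^sup>2) * cnj (z l) / 2)
      = cnj (\<Sum>l\<in>L. complex_of_real ((cmod (a l))\<^sup>2) * z l / 2)"
    by simp
  also have "(\<Sum>l\<in>L. complex_of_real ((cmod (a l))\<^sup>2) * (1::complex) / 2) = 1
      \<longleftrightarrow> (\<Sum>l\<in>L - {0}. complex_of_real ((cmod (a l))\<^sup>2)) = 1"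
    unfolding split by auto
  also have "\<dots> \<longleftrightarrow> (\<Sum>l\<in>L - {0}. (cmod (a l))\<^sup>2) = 1"
    by (simp only: of_real_sum[symmetric] of_real_eq_1_iff)
  also have "(\<Sum>l\<in>L. complex_of_real ((cmod (a l))\<^sup>2) * z l / 2)
      = (1 + (\<Sum>l\<in>L - {0}. complex_of_real ((cmod (a l))\<^sup>2) * z l)) / 2"
    unfolding split by (simp add: z_def)
  finally show ?thesis by (simp only: complex_cnj_zero_iff) (auto simp: add_eq_0_iff)
qed

text \<open>A weighted average of points of the unit circle, with positive weights, equals -1 only
  if every point is -1.\<close>

lemma ortho_columns_iff_half_odd:
  assumes "R \<noteq> 0" "b \<noteq> 0" "finite L" "0 \<in> L" "\<forall>l\<in>L. a l \<noteq> 0" "a 0 = 1"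
  shows "ortho_columns R {0, b} L a \<longleftrightarrow>
    half_odd_freqs R b L \<and> (\<Sum>l\<in>L - {0}. (cmod (a l))\<^sup>2) = 1"
proof -
  define z where "z l = expo (real_of_int l * real_of_int b / real_of_int R) 1" for l
  define x where "x l = 2 * pi * (real_of_int l * real_of_int b / real_of_int R)" for l :: int
  have Re_z: "Re (z l) = cos (x l)" for l by (simp add: z_def x_def expo_eq_cis)
  have "half_odd_freqs R b L" if one: "(\<Sum>l\<in>L - {0}. (cmod (a l))\<^sup>2) = 1"
    and mone: "(\<Sum>l\<in>L - {0}. complex_of_real ((cmod (a l))\<^sup>2) * z l) = -1"
  proof -
    have "(\<Sum>l\<in>L - {0}. (cmod (a l))\<^sup>2 * cos (x l)) = -1"
      using arg_cong[OF mone, of Re] by (simp add: Re_z)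
    \<comment> \<open>The real part of the second equation is added to the first, so that
      nonnegative terms sum to zero and each of them vanishes.\<close>
    then have "(\<Sum>l\<in>L - {0}. (cmod (a l))\<^sup>2 * (1 + cos (x l))) = 0"
      using one by (simp add: distrib_left sum.distrib)
    moreover have "0 \<le> (cmod (a l))\<^sup>2 * (1 + cos (x l))" for l
      using cos_ge_minus_one[of "x l"] by (intro mult_nonneg_nonneg zero_le_power2) linarith
    ultimately have "\<forall>l\<in>L - {0}. (cmod (a l))\<^sup>2 * (1 + cos (x l)) = 0"
      using assms(3) by (subst (asm) sum_nonneg_eq_0_iff) auto
    then have "cos (x l) = -1" if "l \<in> L - {0}" for l
      using that assms(5) by (force simp: add_eq_0_iff)
    then have "\<exists>n::int. x l = (2 * n + 1) * pi" if "l \<in> L - {0}" for l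
      using that by (simp add: cos_eq_minus1)
    moreover have "\<exists>m. odd m \<and> 2 * l * b = R * m" if "x l = (2 * real_of_int n + 1) * pi" for l n
    proof (intro exI conjI)
      have "2 * real_of_int l * b = real_of_int R * (2 * real_of_int n + 1)"
        using that assms(1) by (simp add: x_def divide_simps) (simp add: mult_ac)
      then show "2 * l * b = R * (2 * n + 1)"
        by (metis (no_types, opaque_lifting) of_int_1 of_int_add of_int_eq_iff of_int_mult of_int_numeral)
    qed simp
    ultimately show ?thesis unfolding half_odd_freqs_def by blast
  qed
  moreover have "(\<Sum>l\<in>L - {0}. complex_of_real ((cmod (a l))\<^sup>2) * z l) = -1"
    if "half_odd_freqs R b L" and one: "(\<Sum>l\<in>L - {0}. (cmod (a l))\<^sup>2) = 1"
  proof -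
    have "z l = -1" if "l \<in> L - {0}" for l
      using that \<open>half_odd_freqs R b L\<close> expo_half_odd[OF assms(1)] unfolding half_odd_freqs_def z_def by blast
    then have "(\<Sum>l\<in>L - {0}. complex_of_real ((cmod (a l))\<^sup>2) * z l)
      = (\<Sum>l\<in>L - {0}. complex_of_real (- ((cmod (a l))\<^sup>2)))"
      by (intro sum.cong) auto
    also have "\<dots> = of_real (- (\<Sum>l\<in>L - {0}. (cmod (a l))\<^sup>2))"
      unfolding of_real_sum[symmetric] by (simp only: sum_negf)
    finally show ?thesis using one by simp
  qed
  ultimately show ?thesis
    using ortho_columns_iff[of b L a R] assms unfolding z_def by blast
qed

section \<open>Square-integrable functions for a self-similar measure\<close>

lemma cmod_add_sq_le: "(cmod (x + y))\<^sup>2 \<le> 2 * (cmod x)\<^sup>2 + 2 * (cmod y)\<^sup>2"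
proof -
  have "(cmod (x + y))\<^sup>2 \<le> (cmod x + cmod y)\<^sup>2" by (intro power_mono norm_triangle_ineq) simp
  also have "\<dots> \<le> 2 * (cmod x)\<^sup>2 + 2 * (cmod y)\<^sup>2"
    using zero_le_power2[of "cmod x - cmod y"] by (simp add: power2_eq_square algebra_simps)
  finally show ?thesis .
qed

lemma cmod_parallelogram: "(cmod (x + y))\<^sup>2 + (cmod (x - y))\<^sup>2 = 2 * (cmod x)\<^sup>2 + 2 * (cmod y)\<^sup>2"
  unfolding cmod_power2 by (simp add: power2_eq_square algebra_simps)

lemma tau_measurable [measurable]: "tau R c \<in> borel_measurable borel"
  unfolding tau_def by measurable

text \<open>Building on \<open>real_distribution\<close> makes the characteristic function of M and
  its continuity available.\<close>

locale self_similar_measure = real_distribution M for M :: "real measure" +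
  fixes R b :: int
  assumes R_ge: "\<bar>R\<bar> \<ge> 2"
    and measure_self_similar: "\<And>E. E \<in> sets borel \<Longrightarrow>
      measure M E = (measure M (tau R 0 -` E) + measure M (tau R b -` E)) / 2"
begin

lemma R_nonzero [simp]: "R \<noteq> 0"
  using R_ge by auto

lemma tau_vimage_sets [measurable]: "E \<in> sets borel \<Longrightarrow> tau R c -` E \<in> sets borel"
  using measurable_sets[OF tau_measurable, of E R c] by simp

text \<open>The identity holds for indicators by self-similarity, and both sides are additive,
  homogeneous and continuous along increasing limits. The factor 2 on the left avoids division in
  the extended nonnegative reals.\<close>

lemma nn_integral_self_similar:
  assumes "f \<in> borel_measurable borel"
  shows "2 * (\<integral>\<^sup>+x. f x \<partial>M) = (\<integral>\<^sup>+x. f (tau R 0 x) \<partial>M) + (\<integral>\<^sup>+x. f (tau R b x) \<partial>M)"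
  using assms
proof (induction rule: borel_measurable_induct)
  case (cong f g)
  then show ?case by simp
next
  case (set A)
  have ind: "(\<integral>\<^sup>+x. indicator A (tau R c x) \<partial>M) = emeasure M (tau R c -` A)" for c
  proof -
    have "(\<integral>\<^sup>+x. indicator A (tau R c x) \<partial>M) = (\<integral>\<^sup>+x. indicator (tau R c -` A) x \<partial>M)"
      by (simp add: indicator_def of_bool_def)
    also have "\<dots> = emeasure M (tau R c -` A)"
      using set by (intro nn_integral_indicator) simp
    finally show ?thesis .
  qed
  have "2 * measure M A = measure M (tau R 0 -` A) + measure M (tau R b -` A)"
    using measure_self_similar[OF set] by simp
  then have "ennreal (2 * measure M A) = ennreal (measure M (tau R 0 -` A) + measure M (tau R b -` A))"
    by simp
  then show ?case using set unfolding ind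
    by (simp add: emeasure_eq_measure ennreal_mult' ennreal_plus)
next
  case (mult u c)
  have "2 * (\<integral>\<^sup>+x. c * u x \<partial>M) = c * (2 * (\<integral>\<^sup>+x. u x \<partial>M))"
    using mult by (simp add: nn_integral_cmult mult_ac)
  also have "\<dots> = c * (\<integral>\<^sup>+x. u (tau R 0 x) \<partial>M) + c * (\<integral>\<^sup>+x. u (tau R b x) \<partial>M)"
    using mult by (simp add: distrib_left)
  finally show ?case using mult(2) by (simp add: nn_integral_cmult)
next
  case (add u v)
  have "2 * (\<integral>\<^sup>+x. v x + u x \<partial>M) = 2 * (\<integral>\<^sup>+x. v x \<partial>M) + 2 * (\<integral>\<^sup>+x. u x \<partial>M)"
    using add by (simp add: nn_integral_add distrib_left)
  with add show ?case by (simp add: nn_integral_add add_ac)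
next
  case (seq U)
  have mono: "incseq (\<lambda>i x. U i (tau R c x))" for c
    using seq(3) by (auto simp: incseq_def le_fun_def)
  have "2 * (\<integral>\<^sup>+x. (SUP i. U i x) \<partial>M) = (SUP i. 2 * (\<integral>\<^sup>+x. U i x \<partial>M))"
    using seq by (simp add: nn_integral_monotone_convergence_SUP SUP_mult_left_ennreal)
  also have "\<dots> = (SUP i. (\<integral>\<^sup>+x. U i (tau R 0 x) \<partial>M) + (\<integral>\<^sup>+x. U i (tau R b x) \<partial>M))"
    using seq by simp
  also have "\<dots> = (SUP i. \<integral>\<^sup>+x. U i (tau R 0 x) \<partial>M) + (SUP i. \<integral>\<^sup>+x. U i (tau R b x) \<partial>M)"
    using mono by (intro ennreal_SUP_add) (auto simp: incseq_def le_fun_def intro!: nn_integral_mono)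
  also have "\<dots> = (\<integral>\<^sup>+x. (SUP i. U i (tau R 0 x)) \<partial>M) + (\<integral>\<^sup>+x. (SUP i. U i (tau R b x)) \<partial>M)"
    using seq(1) mono by (simp add: nn_integral_monotone_convergence_SUP)
  finally show ?case by (simp add: image_comp)
qed

text \<open>Each of the two branches is bounded by their sum, which is twice the integral of
  \<open>norm (f x)\<close>.\<close>

lemma integrable_tau:
  fixes f :: "real \<Rightarrow> 'a::{banach, second_countable_topology}"
  assumes f: "integrable M f" and c: "c \<in> {0, b}"
  shows "integrable M (\<lambda>x. f (tau R c x))"
proof (rule integrableI_bounded)
  have [measurable]: "f \<in> borel_measurable borel"
    using borel_measurable_integrable[OF f] by simp
  show "(\<lambda>x. f (tau R c x)) \<in> borel_measurable M" by measurable
  have "(\<integral>\<^sup>+x. norm (f (tau R c x)) \<partial>M)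
      \<le> (\<integral>\<^sup>+x. norm (f (tau R 0 x)) \<partial>M) + (\<integral>\<^sup>+x. norm (f (tau R b x)) \<partial>M)"
    using c by auto
  also have "\<dots> = 2 * (\<integral>\<^sup>+x. norm (f x) \<partial>M)"
    by (rule nn_integral_self_similar[symmetric]) measurable
  also have "\<dots> < \<infinity>"
    using f by (simp add: integrable_iff_bounded ennreal_mult_less_top)
  finally show "(\<integral>\<^sup>+x. norm (f (tau R c x)) \<partial>M) < \<infinity>" .
qed

lemma integral_self_similar:
  fixes f :: "real \<Rightarrow> 'a::{banach, second_countable_topology}"
  assumes "integrable M f"
  shows "(LINT x|M. f x) = ((LINT x|M. f (tau R 0 x)) + (LINT x|M. f (tau R b x))) /\<^sub>R 2"
  using assms
proof (induction rule: integrable_induct)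
  case (base A c)
  then have A: "A \<in> sets borel" by simp
  have ind: "(LINT x|M. indicator A (tau R c' x) *\<^sub>R c) = measure M (tau R c' -` A) *\<^sub>R c" for c'
  proof -
    have "(LINT x|M. indicator A (tau R c' x) *\<^sub>R c) = (LINT x|M. indicator (tau R c' -` A) x *\<^sub>R c)"
      by (simp add: indicator_def of_bool_def)
    then show ?thesis using A by (simp add: emeasure_finite less_top[symmetric])
  qed
  have "(LINT x|M. indicator A x *\<^sub>R c) = measure M A *\<^sub>R c"
    using A by (simp add: emeasure_finite less_top[symmetric])
  then show ?case unfolding ind measure_self_similar[OF A]
    by (simp add: scaleR_add_left scaleR_add_right add_divide_distrib)
next
  case (add f g)
  then show ?case by (simp add: integrable_tau scaleR_add_right)
next
  case (lim f s)
  have [measurable]: "f \<in> borel_measurable borel" "s i \<in> borel_measurable borel" for i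
    using borel_measurable_integrable[OF lim.hyps(4)] borel_measurable_integrable[OF lim.hyps(1)] by auto
  \<comment> \<open>One dominated convergence argument with an inner map \<open>h\<close> serves
    both branches and the identity.\<close>
  have lims: "(\<lambda>i. LINT x|M. s i (h x)) \<longlonglongrightarrow> (LINT x|M. f (h x))"
    if [measurable]: "h \<in> borel_measurable borel" and int: "integrable M (\<lambda>x. f (h x))" for h
  proof (rule integral_dominated_convergence[where w = "\<lambda>x. 2 * norm (f (h x))"])
    show "integrable M (\<lambda>x. 2 * norm (f (h x)))" using int by simp
  qed (use lim in auto)
  have "(\<lambda>i. LINT x|M. s i x) \<longlonglongrightarrow> ((LINT x|M. f (tau R 0 x)) + (LINT x|M. f (tau R b x))) /\<^sub>R 2"
    unfolding lim.IH
    by (intro tendsto_intros lims) (auto intro: integrable_tau lim)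
  moreover have "(\<lambda>i. LINT x|M. s i x) \<longlonglongrightarrow> (LINT x|M. f x)"
    using lims[of "\<lambda>x. x"] lim by simp
  ultimately show ?case by (rule LIMSEQ_unique[THEN sym])
qed

section \<open>Algebra of square-integrable functions\<close>

lemma in_L2_measurable: "in_L2 M f \<Longrightarrow> f \<in> borel_measurable borel"
  unfolding in_L2_def measurable_cong_sets[OF events_eq_borel refl] by simp

lemma in_L2_integrable:
  assumes "in_L2 M f"
  shows "integrable M f"
proof (rule Bochner_Integration.integrable_bound)
  show "integrable M (\<lambda>x. 1 + (cmod (f x))\<^sup>2)" using assms by (simp add: in_L2_def)
  show "AE x in M. norm (f x) \<le> norm (1 + (cmod (f x))\<^sup>2)"
  proof (rule AE_I2)
    fix x
    have "cmod (f x) \<le> 1 + (cmod (f x))\<^sup>2"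
      using zero_le_power2[of "cmod (f x) - 1/2"] by (simp add: power2_eq_square algebra_simps)
    then show "norm (f x) \<le> norm (1 + (cmod (f x))\<^sup>2)" by simp
  qed
qed (use assms in \<open>simp add: in_L2_def\<close>)

lemma in_L2_bounded_mult:
  assumes "in_L2 M f" and [measurable]: "g \<in> borel_measurable borel" and g: "\<And>x. cmod (g x) \<le> K"
  shows "in_L2 M (\<lambda>x. g x * f x)"
  unfolding in_L2_def
proof
  have [measurable]: "f \<in> borel_measurable borel" using assms(1) by (rule in_L2_measurable)
  show "(\<lambda>x. g x * f x) \<in> borel_measurable M" by measurable
  show "integrable M (\<lambda>x. (cmod (g x * f x))\<^sup>2)"
  proof (rule Bochner_Integration.integrable_bound)
    show "integrable M (\<lambda>x. K\<^sup>2 * (cmod (f x))\<^sup>2)" using assms(1) by (simp add: in_L2_def)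
    show "AE x in M. norm ((cmod (g x * f x))\<^sup>2) \<le> norm (K\<^sup>2 * (cmod (f x))\<^sup>2)"
      by (auto simp: norm_mult power_mult_distrib intro!: mult_right_mono power_mono g)
  qed measurable
qed

lemma in_L2_cmult: "in_L2 M f \<Longrightarrow> in_L2 M (\<lambda>x. c * f x)"
  by (rule in_L2_bounded_mult[where K = "cmod c"]) auto

lemma in_L2_bounded:
  assumes "g \<in> borel_measurable borel" "\<And>x. cmod (g x) \<le> K"
  shows "in_L2 M g"
  using in_L2_bounded_mult[OF _ assms, of "\<lambda>_. 1"] by (simp add: in_L2_def)

lemma in_L2_expo [simp]: "in_L2 M (expo t)"
  by (rule in_L2_bounded[where K = 1]) auto

lemma in_L2_add:
  assumes "in_L2 M f" "in_L2 M g"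
  shows "in_L2 M (\<lambda>x. f x + g x)"
  unfolding in_L2_def
proof
  have [measurable]: "f \<in> borel_measurable borel" "g \<in> borel_measurable borel"
    using assms by (auto intro: in_L2_measurable)
  show "(\<lambda>x. f x + g x) \<in> borel_measurable M" by measurable
  show "integrable M (\<lambda>x. (cmod (f x + g x))\<^sup>2)"
  proof (rule Bochner_Integration.integrable_bound)
    show "integrable M (\<lambda>x. 2 * (cmod (f x))\<^sup>2 + 2 * (cmod (g x))\<^sup>2)"
      using assms by (simp add: in_L2_def)
    show "AE x in M. norm ((cmod (f x + g x))\<^sup>2) \<le> norm (2 * (cmod (f x))\<^sup>2 + 2 * (cmod (g x))\<^sup>2)"
      using cmod_add_sq_le by auto
  qed measurable
qed

lemma in_L2_diff:
  assumes "in_L2 M f" "in_L2 M g"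
  shows "in_L2 M (\<lambda>x. f x - g x)"
  using in_L2_add[OF assms(1) in_L2_cmult[OF assms(2), of "-1"]] by simp

lemma in_L2_tau:
  assumes "in_L2 M f" "c \<in> {0, b}"
  shows "in_L2 M (\<lambda>x. f (tau R c x))"
  unfolding in_L2_def
proof
  have [measurable]: "f \<in> borel_measurable borel" using assms(1) by (rule in_L2_measurable)
  show "(\<lambda>x. f (tau R c x)) \<in> borel_measurable M" by measurable
  show "integrable M (\<lambda>x. (cmod (f (tau R c x)))\<^sup>2)"
    using assms integrable_tau[of "\<lambda>x. (cmod (f x))\<^sup>2" c] by (simp add: in_L2_def)
qed

definition L2_sq :: "(real \<Rightarrow> complex) \<Rightarrow> real" where
  "L2_sq f = (LINT x|M. (cmod (f x))\<^sup>2)"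

lemma L2_sq_cmult: "L2_sq (\<lambda>x. c * f x) = (cmod c)\<^sup>2 * L2_sq f"
  by (simp add: L2_sq_def norm_mult power_mult_distrib)

lemma L2_sq_expo [simp]: "L2_sq (expo t) = 1"
  using prob_space by (simp add: L2_sq_def)

lemma L2_sq_parallelogram:
  assumes "in_L2 M f" "in_L2 M g"
  shows "L2_sq (\<lambda>x. f x + g x) + L2_sq (\<lambda>x. f x - g x) = 2 * L2_sq f + 2 * L2_sq g"
proof -
  have "L2_sq (\<lambda>x. f x + g x) + L2_sq (\<lambda>x. f x - g x)
      = (LINT x|M. (cmod (f x + g x))\<^sup>2 + (cmod (f x - g x))\<^sup>2)"
    unfolding L2_sq_def using in_L2_add[OF assms] in_L2_diff[OF assms]
    by (subst Bochner_Integration.integral_add) (auto simp: in_L2_def)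
  also have "\<dots> = 2 * L2_sq f + 2 * L2_sq g"
    unfolding cmod_parallelogram L2_sq_def using assms by (simp add: in_L2_def)
  finally show ?thesis .
qed

lemma L2_inner_integrable:
  assumes "in_L2 M f"
  shows "integrable M (\<lambda>x. f x * cnj (c * expo t x))"
proof -
  have "in_L2 M (\<lambda>x. cnj (c * expo t x) * f x)"
    unfolding complex_cnj_mult cnj_expo
    by (rule in_L2_bounded_mult[OF assms, where K = "cmod c"]) (auto simp: norm_mult)
  from in_L2_integrable[OF this] show ?thesis by (simp add: mult_ac)
qed

text \<open>Cauchy-Schwarz against the constant 1, obtained from the nonnegative variance of
  \<open>cmod (f x)\<close>. This is Bessel's inequality for the empty word.\<close>

lemma L2_inner_one_sq_le:
  assumes "in_L2 M f"
  shows "(cmod (L2_inner M f (\<lambda>x. 1)))\<^sup>2 \<le> L2_sq f"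
proof -
  have int: "integrable M (\<lambda>x. cmod (f x))" "integrable M (\<lambda>x. (cmod (f x))\<^sup>2)"
    using assms in_L2_integrable[OF assms] by (auto simp: in_L2_def)
  have "cmod (L2_inner M f (\<lambda>x. 1)) \<le> (LINT x|M. cmod (f x))"
    unfolding L2_inner_def by (simp add: integral_norm_bound)
  then have "(cmod (L2_inner M f (\<lambda>x. 1)))\<^sup>2 \<le> (LINT x|M. cmod (f x))\<^sup>2"
    by (intro power_mono) auto
  also have "\<dots> \<le> L2_sq f"
    using variance_positive[of "\<lambda>x. cmod (f x)"] variance_eq[OF int] by (simp add: L2_sq_def)
  finally show ?thesis .
qed

end

section \<open>Transfer operators and the defect\<close>

locale self_similar_frame = self_similar_measure M R b for M :: "real measure" and R b :: int +
  fixes L :: "int set" and a :: "int \<Rightarrow> complex"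
  assumes finite_L: "finite L" and zero_L: "0 \<in> L" and a_zero: "a 0 = 1"
    and half_odd: "half_odd_freqs R b L"
    and weights: "(\<Sum>l\<in>L - {0}. (cmod (a l))\<^sup>2) = 1"
begin

text \<open>On functions \<open>g\<close> of period 1 this is the adjoint of multiplying
  \<open>g (R * x)\<close> by \<open>a l * expo l x\<close>, the operation that puts the letter l in
  front of a word.\<close>

definition transfer :: "int \<Rightarrow> (real \<Rightarrow> complex) \<Rightarrow> real \<Rightarrow> complex" where
  "transfer l f y = cnj (a l) / 2 *
     (cnj (expo (of_int l) (tau R 0 y)) * f (tau R 0 y) + cnj (expo (of_int l) (tau R b y)) * f (tau R b y))"

definition frame :: "int list \<Rightarrow> real \<Rightarrow> complex" where
  "frame ws x = word_weight a ws * expo (of_int (word_freq R ws)) x"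

text \<open>The arithmetic condition on L enters the analysis here: the two branch points differ by
  \<open>b / R\<close>, where a nonzero frequency picks up the sign -1.\<close>

lemma expo_tau_b:
  assumes "l \<in> L"
  shows "expo (of_int l) (tau R b y) = (if l = 0 then 1 else -1) * expo (of_int l) (tau R 0 y)"
proof -
  have "expo (of_int l) (tau R b y)
      = expo (real_of_int l * real_of_int b / real_of_int R) 1 * expo (of_int l) (tau R 0 y)"
    by (simp add: expo_eq_cis cis_mult tau_def add_divide_distrib distrib_left add_ac mult.assoc)
  moreover have "expo (real_of_int l * real_of_int b / real_of_int R) 1 = -1" if "l \<noteq> 0"
    using that assms half_odd expo_half_odd[OF R_nonzero] unfolding half_odd_freqs_def by blast
  ultimately show ?thesis by simp
qed

lemma in_L2_transfer:
  assumes "in_L2 M f"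
  shows "in_L2 M (transfer l f)"
  unfolding transfer_def cnj_expo
  by (intro in_L2_cmult in_L2_add in_L2_bounded_mult[where K = 1] in_L2_tau assms) auto

text \<open>With \<open>u\<close> and \<open>v\<close> the values of f at the two branch points, the
  letter 0 sees \<open>u + v\<close> and every other letter sees \<open>u - v\<close>. The nonzero
  letters have total weight 1, so the parallelogram law finishes.\<close>

lemma sum_cmod_transfer_sq:
  "(\<Sum>l\<in>L. (cmod (transfer l f y))\<^sup>2) = ((cmod (f (tau R 0 y)))\<^sup>2 + (cmod (f (tau R b y)))\<^sup>2) / 2"
proof -
  define u v where "u = f (tau R 0 y)" and "v = f (tau R b y)"
  have t: "transfer l f y = cnj (a l) / 2 * cnj (expo (of_int l) (tau R 0 y)) * (u + (if l = 0 then 1 else -1) * v)"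
    if "l \<in> L" for l
    by (simp add: transfer_def expo_tau_b[OF that] u_def v_def algebra_simps)
  have c: "(cmod (transfer l f y))\<^sup>2 = (cmod (a l))\<^sup>2 / 4 * (cmod (u + (if l = 0 then 1 else -1) * v))\<^sup>2"
    if "l \<in> L" for l
    unfolding t[OF that] norm_mult power_mult_distrib by (simp add: norm_divide power_divide)
  have "(\<Sum>l\<in>L. (cmod (transfer l f y))\<^sup>2)
      = (cmod (transfer 0 f y))\<^sup>2 + (\<Sum>l\<in>L - {0}. (cmod (transfer l f y))\<^sup>2)"
    by (rule sum.remove[OF finite_L zero_L])
  also have "(\<Sum>l\<in>L - {0}. (cmod (transfer l f y))\<^sup>2) = (\<Sum>l\<in>L - {0}. (cmod (a l))\<^sup>2 * ((cmod (u - v))\<^sup>2 / 4))"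
    by (intro sum.cong) (auto simp: c)
  also have "\<dots> = (cmod (u - v))\<^sup>2 / 4"
    unfolding sum_distrib_right[symmetric] weights by simp
  also have "(cmod (transfer 0 f y))\<^sup>2 = (cmod (u + v))\<^sup>2 / 4"
    by (simp add: c zero_L a_zero)
  finally show ?thesis using cmod_parallelogram[of u v] by (simp add: u_def v_def)
qed

lemma sum_L2_sq_transfer:
  assumes "in_L2 M f"
  shows "(\<Sum>l\<in>L. L2_sq (transfer l f)) = L2_sq f"
proof -
  have int: "integrable M (\<lambda>x. (cmod (f x))\<^sup>2)" using assms by (simp add: in_L2_def)
  have "(\<Sum>l\<in>L. L2_sq (transfer l f)) = (LINT y|M. (\<Sum>l\<in>L. (cmod (transfer l f y))\<^sup>2))"
    unfolding L2_sq_def using in_L2_transfer[OF assms]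
    by (subst Bochner_Integration.integral_sum) (auto simp: in_L2_def)
  also have "\<dots> = ((LINT y|M. (cmod (f (tau R 0 y)))\<^sup>2) + (LINT y|M. (cmod (f (tau R b y)))\<^sup>2)) / 2"
    unfolding sum_cmod_transfer_sq using integrable_tau[OF int] by simp
  also have "\<dots> = L2_sq f"
    unfolding L2_sq_def by (subst integral_self_similar[OF int]) simp
  finally show ?thesis .
qed

section \<open>Frame functions, their coefficients and Bessel's inequality\<close>

lemma frame_Nil [simp]: "frame [] = (\<lambda>x. 1)"
  by (simp add: frame_def fun_eq_iff)

lemma frame_append_zero: "frame (ws @ [0]) = frame ws"
  by (simp add: frame_def fun_eq_iff word_freq_append_zero word_weight_append_zero a_zero)

text \<open>R times \<open>tau R c y\<close> is \<open>y + c\<close>, and an exponential of integer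
  frequency does not notice the integer shift c.\<close>

lemma frame_Cons_tau:
  fixes c :: int
  shows "frame (l # ws) (tau R c y) = a l * expo (of_int l) (tau R c y) * frame ws y"
proof -
  define k where "k = word_freq R ws"
  have "expo (real_of_int R * real_of_int k) (tau R c y) = expo (of_int k) y * expo (of_int k) (of_int c)"
    unfolding expo_eq_cis cis_mult tau_def by (rule arg_cong[of _ _ cis]) (simp add: field_simps)
  also have "expo (real_of_int k) (real_of_int c) = 1"
    by (rule expo_eq_1_if_Ints) auto
  finally show ?thesis by (simp add: frame_def expo_add k_def)
qed

lemma L2_inner_frame_integrable: "in_L2 M f \<Longrightarrow> integrable M (\<lambda>x. f x * cnj (frame ws x))"
  unfolding frame_def by (rule L2_inner_integrable)

lemma L2_inner_frame_Cons:
  assumes "in_L2 M f"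
  shows "L2_inner M f (frame (l # ws)) = L2_inner M (transfer l f) (frame ws)"
proof -
  define F where "F x = f x * cnj (frame (l # ws) x)" for x
  have int: "integrable M F" unfolding F_def using assms by (rule L2_inner_frame_integrable)
  have "L2_inner M f (frame (l # ws)) = (LINT y|M. F (tau R 0 y) + F (tau R b y)) /\<^sub>R 2"
    using integral_self_similar[OF int] integrable_tau[OF int] by (simp add: L2_inner_def F_def)
  also have "\<dots> = (LINT y|M. (F (tau R 0 y) + F (tau R b y)) /\<^sub>R 2)"
    by simp
  also have "(\<lambda>y. (F (tau R 0 y) + F (tau R b y)) /\<^sub>R 2) = (\<lambda>y. transfer l f y * cnj (frame ws y))"
    by (simp add: F_def frame_Cons_tau transfer_def scaleR_conv_of_real field_simps)
  finally show ?thesis by (simp add: L2_inner_def)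
qed

text \<open>Fixed length with trailing zeros allowed: the recursion on the first letter is then
  exact, and each frame function of a word in \<open>Omega L\<close> of length at most n occurs
  once, padded by zeros.\<close>

definition words :: "nat \<Rightarrow> int list set" where
  "words n = {ws. set ws \<subseteq> L \<and> length ws = n}"

lemma finite_words [simp]: "finite (words n)"
  unfolding words_def by (rule finite_lists_length_eq[OF finite_L])

definition coeff_sq :: "nat \<Rightarrow> (real \<Rightarrow> complex) \<Rightarrow> real" where
  "coeff_sq n f = (\<Sum>ws\<in>words n. (cmod (L2_inner M f (frame ws)))\<^sup>2)"

definition defect :: "nat \<Rightarrow> (real \<Rightarrow> complex) \<Rightarrow> real" where
  "defect n f = L2_sq f - coeff_sq n f"

lemma words_0 [simp]: "words 0 = {[]}"
  by (auto simp: words_def)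

lemma coeff_sq_Suc:
  assumes "in_L2 M f"
  shows "coeff_sq (Suc n) f = (\<Sum>l\<in>L. coeff_sq n (transfer l f))"
proof -
  have eq: "words (Suc n) = (\<lambda>(l, ws). l # ws) ` (L \<times> words n)"
    by (force simp: words_def length_Suc_conv image_iff)
  have "inj_on (\<lambda>(l, ws). l # ws) (L \<times> words n)" by (auto simp: inj_on_def)
  then have "coeff_sq (Suc n) f = (\<Sum>(l, ws)\<in>L \<times> words n. (cmod (L2_inner M f (frame (l # ws))))\<^sup>2)"
    unfolding coeff_sq_def eq by (simp add: sum.reindex case_prod_unfold comp_def)
  then show ?thesis
    by (simp add: sum.cartesian_product[symmetric] coeff_sq_def L2_inner_frame_Cons[OF assms])
qed

lemma defect_Suc:
  assumes "in_L2 M f"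
  shows "defect (Suc n) f = (\<Sum>l\<in>L. defect n (transfer l f))"
  by (simp add: defect_def coeff_sq_Suc[OF assms] sum_subtractf sum_L2_sq_transfer[OF assms])

text \<open>Bessel's inequality, by induction: the defect at length \<open>Suc n\<close> is the sum
  of the defects at length n of the transferred functions.\<close>

lemma defect_nonneg: "in_L2 M f \<Longrightarrow> 0 \<le> defect n f"
proof (induction n arbitrary: f)
  case 0
  then show ?case using L2_inner_one_sq_le by (simp add: defect_def coeff_sq_def)
next
  case (Suc n)
  then show ?case by (simp add: defect_Suc sum_nonneg in_L2_transfer)
qed

lemma defect_le: "defect n f \<le> L2_sq f"
  by (simp add: defect_def coeff_sq_def sum_nonneg)

lemma defect_cmult: "defect n (\<lambda>x. c * f x) = (cmod c)\<^sup>2 * defect n f"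
proof -
  have "L2_inner M (\<lambda>x. c * f x) g = c * L2_inner M f g" for g
    by (simp add: L2_inner_def mult.assoc)
  then show ?thesis
    by (simp add: defect_def L2_sq_cmult coeff_sq_def norm_mult power_mult_distrib
        sum_distrib_left right_diff_distrib)
qed

lemma defect_parallelogram:
  assumes f: "in_L2 M f" and g: "in_L2 M g"
  shows "defect n (\<lambda>x. f x + g x) + defect n (\<lambda>x. f x - g x) = 2 * defect n f + 2 * defect n g"
proof -
  have "L2_inner M (\<lambda>x. f x + g x) (frame ws) = L2_inner M f (frame ws) + L2_inner M g (frame ws)"
    "L2_inner M (\<lambda>x. f x - g x) (frame ws) = L2_inner M f (frame ws) - L2_inner M g (frame ws)" for ws
    unfolding L2_inner_def distrib_right left_diff_distrib
    using L2_inner_frame_integrable[OF f] L2_inner_frame_integrable[OF g] by simp_all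
  then have "coeff_sq n (\<lambda>x. f x + g x) + coeff_sq n (\<lambda>x. f x - g x) = 2 * coeff_sq n f + 2 * coeff_sq n g"
    unfolding coeff_sq_def sum.distrib[symmetric] sum_distrib_left by (simp add: cmod_parallelogram)
  then show ?thesis using L2_sq_parallelogram[OF f g] by (simp add: defect_def)
qed

text \<open>The parallelogram law for a nonnegative quadratic form replaces the triangle inequality
  for its square root, at the price of the factor 2.\<close>

lemma defect_add_le:
  assumes "in_L2 M f" "in_L2 M g"
  shows "defect n (\<lambda>x. f x + g x) \<le> 2 * defect n f + 2 * defect n g"
  using defect_parallelogram[OF assms, of n] defect_nonneg[OF in_L2_diff[OF assms], of n] by linarith

text \<open>Splitting by the last letter instead of the first: a final 0 changes neither weight nor
  frequency, so only words with a nonzero last letter are new. Monotonicity in n and the link with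
  \<open>Omega L\<close> both follow from this.\<close>

lemma coeff_sq_Suc_append:
  "coeff_sq (Suc n) f = coeff_sq n f +
     (\<Sum>ws\<in>{ws \<in> words (Suc n). last ws \<noteq> 0}. (cmod (L2_inner M f (frame ws)))\<^sup>2)"
proof -
  have eq: "words (Suc n) = (\<lambda>ws. ws @ [0]) ` words n \<union> {ws \<in> words (Suc n). last ws \<noteq> 0}"
    using zero_L by (auto simp: words_def length_Suc_conv_rev image_iff)
  have "coeff_sq (Suc n) f = (\<Sum>ws\<in>(\<lambda>ws. ws @ [0]) ` words n. (cmod (L2_inner M f (frame ws)))\<^sup>2) +
     (\<Sum>ws\<in>{ws \<in> words (Suc n). last ws \<noteq> 0}. (cmod (L2_inner M f (frame ws)))\<^sup>2)"
    unfolding coeff_sq_def by (subst eq, rule sum.union_disjoint) auto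
  then show ?thesis
    by (simp add: sum.reindex inj_on_def frame_append_zero coeff_sq_def)
qed

lemma coeff_sq_eq_Omega:
  "coeff_sq n f = (\<Sum>ws\<in>{ws \<in> Omega L. length ws \<le> n}. (cmod (L2_inner M f (frame ws)))\<^sup>2)"
proof (induction n)
  case 0
  have "{ws \<in> Omega L. length ws \<le> 0} = {[]}" by (auto simp: Omega_def)
  then show ?case by (simp add: coeff_sq_def)
next
  case (Suc n)
  have "{ws \<in> Omega L. length ws \<le> Suc n} =
      {ws \<in> Omega L. length ws \<le> n} \<union> {ws \<in> words (Suc n). last ws \<noteq> 0}"
    by (auto simp: Omega_def words_def)
  moreover have "finite {ws \<in> Omega L. length ws \<le> n}"
    by (rule finite_subset[OF _ finite_lists_length_le[OF finite_L, of n]]) (auto simp: Omega_def)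
  moreover have "{ws \<in> Omega L. length ws \<le> n} \<inter> {ws \<in> words (Suc n). last ws \<noteq> 0} = {}"
    by (auto simp: words_def)
  ultimately show ?case
    using Suc by (simp add: coeff_sq_Suc_append sum.union_disjoint)
qed

lemma decseq_defect: "decseq (\<lambda>n. defect n f)"
  by (rule decseq_SucI) (simp add: defect_def coeff_sq_Suc_append sum_nonneg)

text \<open>All terms are nonnegative. Bessel's inequality bounds every finite partial sum, and the
  words of length at most n come arbitrarily close to the bound.\<close>

lemma has_sum_if_defect_tendsto_0:
  assumes f: "in_L2 M f" and lim: "(\<lambda>n. defect n f) \<longlonglongrightarrow> 0"
  shows "((\<lambda>ws. (cmod (L2_inner M f (frame ws)))\<^sup>2) has_sum L2_sq f) (Omega L)"
  unfolding has_sum_def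
proof (rule increasing_tendsto)
  let ?F = "\<lambda>ws. (cmod (L2_inner M f (frame ws)))\<^sup>2"
  let ?O = "\<lambda>n. {ws \<in> Omega L. length ws \<le> n}"
  have fin: "finite (?O n)" for n
    by (rule finite_subset[OF _ finite_lists_length_le[OF finite_L, of n]]) (auto simp: Omega_def)
  show "\<forall>\<^sub>F X in finite_subsets_at_top (Omega L). sum ?F X \<le> L2_sq f"
  proof (rule eventually_finite_subsets_at_top_weakI)
    fix X assume X: "finite X" "X \<subseteq> Omega L"
    \<comment> \<open>For empty X the maximum is unspecified, but the inclusion is trivial.\<close>
    have "X \<subseteq> ?O (Max (length ` X))" using X by auto
    then have "sum ?F X \<le> coeff_sq (Max (length ` X)) f"
      unfolding coeff_sq_eq_Omega using fin by (intro sum_mono2) auto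
    also have "\<dots> \<le> L2_sq f" using defect_nonneg[OF f] by (simp add: defect_def)
    finally show "sum ?F X \<le> L2_sq f" .
  qed
  fix x assume "x < L2_sq f"
  then have "\<forall>\<^sub>F n in sequentially. defect n f < L2_sq f - x"
    using lim by (intro order_tendstoD) auto
  then obtain n where n: "x < coeff_sq n f"
    by (auto simp: eventually_sequentially defect_def)
  show "\<forall>\<^sub>F X in finite_subsets_at_top (Omega L). x < sum ?F X"
    unfolding eventually_finite_subsets_at_top
  proof (intro exI[of _ "?O n"] conjI allI impI)
    fix Y assume "finite Y \<and> ?O n \<subseteq> Y \<and> Y \<subseteq> Omega L"
    then have "coeff_sq n f \<le> sum ?F Y"
      unfolding coeff_sq_eq_Omega by (intro sum_mono2) auto
    with n show "x < sum ?F Y" by simp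
  qed (use fin in auto)
qed

end

section \<open>The limit defect of an exponential\<close>

text \<open>Dividing b repeatedly by its common factor with R leaves a part coprime to R. This
  provides the fixed multiplier \<open>c\<close> of the maximum argument.\<close>

lemma coprime_part_dvd:
  fixes b R :: int
  assumes "b \<noteq> 0"
  shows "\<exists>c n. coprime c R \<and> b dvd c * R ^ n"
  using assms
proof (induction "nat \<bar>b\<bar>" arbitrary: b rule: less_induct)
  case less
  show ?case
  proof (cases "coprime b R")
    case True
    then show ?thesis by (intro exI[of _ b] exI[of _ 0]) simp
  next
    case False
    define g where "g = gcd b R"
    obtain b' where b': "b = g * b'" unfolding g_def by (meson dvdE gcd_dvd1)
    have "g \<noteq> 1" using False by (auto simp: g_def coprime_iff_gcd_eq_1)
    moreover have "g > 0" using less.prems by (simp add: g_def)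
    ultimately have "g > 1" by simp
    have "b' \<noteq> 0" using b' less.prems by auto
    then have "\<bar>b'\<bar> < \<bar>b\<bar>" using \<open>g > 1\<close> by (simp add: b' abs_mult)
    with less.hyps[of b'] \<open>b' \<noteq> 0\<close> less.prems obtain c n where "coprime c R" "b' dvd c * R ^ n" by auto
    moreover have "g dvd R" by (simp add: g_def)
    ultimately have "coprime c R" "g * b' dvd R * (c * R ^ n)" by (auto intro: mult_dvd_mono)
    then show ?thesis unfolding b' by (intro exI[of _ c] exI[of _ "Suc n"]) (simp add: mult_ac)
  qed
qed

lemma cmod_one_plus_cis_sq: "(cmod (1 + cis (2 * x)))\<^sup>2 = 4 * (cos x)\<^sup>2"
proof -
  have "(cmod (1 + cis (2 * x)))\<^sup>2 = (1 + cos (2 * x))\<^sup>2 + (sin (2 * x))\<^sup>2"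
    by (simp add: cmod_power2)
  also have "\<dots> = 2 + 2 * cos (2 * x)"
    using sin_cos_squared_add[of "2 * x"] by (simp add: power2_eq_square algebra_simps)
  also have "\<dots> = 4 * (cos x)\<^sup>2" by (simp add: cos_double_cos)
  finally show ?thesis .
qed

lemma cos_shift_half_odd_sq:
  assumes "odd (m :: int)"
  shows "(cos (x - of_int m * (pi / 2)))\<^sup>2 = (sin x)\<^sup>2"
proof -
  have c: "cos (of_int m * (pi / 2)) = 0" using assms by (subst cos_zero_iff_int) blast
  then have "(sin (of_int m * (pi / 2)))\<^sup>2 = 1"
    using sin_cos_squared_add[of "of_int m * (pi / 2)"] by simp
  then show ?thesis unfolding cos_diff c by (simp add: power_mult_distrib)
qed

context self_similar_frame
begin

text \<open>Probability of the move from t to \<open>(t - l) / R\<close> in a Markov chain on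
  frequencies; it is the squared modulus of the factor in \<open>transfer_expo\<close>.\<close>

definition step_prob :: "int \<Rightarrow> real \<Rightarrow> real" where
  "step_prob l t = (cmod (a l))\<^sup>2 * (cos (pi * of_int b * (t - of_int l) / of_int R))\<^sup>2"

lemma step_prob_nonneg: "0 \<le> step_prob l t"
  by (simp add: step_prob_def)

lemma step_prob_zero: "step_prob 0 t = (cos (pi * of_int b * t / of_int R))\<^sup>2"
  by (simp add: step_prob_def a_zero)

lemma step_prob_nonzero:
  assumes "l \<in> L - {0}"
  shows "step_prob l t = (cmod (a l))\<^sup>2 * (sin (pi * of_int b * t / of_int R))\<^sup>2"
proof -
  obtain m where m: "odd m" "2 * l * b = R * m" using assms half_odd unfolding half_odd_freqs_def by blast
  have "2 * real_of_int l * b = real_of_int R * m" using m(2) by (metis of_int_mult of_int_numeral)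
  then have "pi * of_int b * (t - of_int l) / of_int R = pi * of_int b * t / of_int R - of_int m * (pi / 2)"
    by (simp add: field_simps)
  then show ?thesis using cos_shift_half_odd_sq[OF m(1)] by (simp add: step_prob_def)
qed

lemma sum_step_prob: "(\<Sum>l\<in>L. step_prob l t) = 1"
proof -
  have "(\<Sum>l\<in>L. step_prob l t) = step_prob 0 t + (\<Sum>l\<in>L - {0}. step_prob l t)"
    by (rule sum.remove[OF finite_L zero_L])
  also have "(\<Sum>l\<in>L - {0}. step_prob l t) = (sin (pi * of_int b * t / of_int R))\<^sup>2"
    using weights by (simp add: step_prob_nonzero sum_distrib_right[symmetric])
  finally show ?thesis by (simp add: step_prob_zero)
qed

text \<open>Exponentials go to multiples of exponentials, so on them the defect recursion becomes an
  average over the next frequencies.\<close>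

lemma transfer_expo:
  "transfer l (expo t) = (\<lambda>y. cnj (a l) / 2 * (1 + cis (2 * (pi * of_int b * (t - of_int l) / of_int R)))
     * expo ((t - of_int l) / of_int R) y)"
proof
  fix y
  have e: "cnj (expo (of_int l) (tau R c y)) * expo t (tau R c y)
      = cis (2 * (pi * of_int c * (t - of_int l) / of_int R)) * expo ((t - of_int l) / of_int R) y" for c
    unfolding cnj_expo unfolding expo_eq_cis cis_mult tau_def
    by (rule arg_cong[of _ _ cis]) (simp add: field_simps)
  show "transfer l (expo t) y = cnj (a l) / 2 * (1 + cis (2 * (pi * of_int b * (t - of_int l) / of_int R)))
     * expo ((t - of_int l) / of_int R) y"
    unfolding transfer_def e by (simp add: algebra_simps)
qed

lemma defect_expo_Suc:
  "defect (Suc n) (expo t) = (\<Sum>l\<in>L. step_prob l t * defect n (expo ((t - of_int l) / of_int R)))"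
  unfolding defect_Suc[OF in_L2_expo] transfer_expo defect_cmult norm_mult power_mult_distrib
    cmod_one_plus_cis_sq step_prob_def
  by (simp add: norm_divide power_divide)

section \<open>The limit defect as an upper semicontinuous harmonic function\<close>

definition limit_defect :: "real \<Rightarrow> real" where
  "limit_defect t = lim (\<lambda>n. defect n (expo t))"

lemma limit_defect_tendsto: "(\<lambda>n. defect n (expo t)) \<longlonglongrightarrow> limit_defect t"
proof -
  have "\<forall>n. 0 \<le> defect n (expo t)" by (simp add: defect_nonneg)
  from decseq_convergent[OF decseq_defect this] obtain c where "(\<lambda>n. defect n (expo t)) \<longlonglongrightarrow> c" .
  then show ?thesis by (simp add: limit_defect_def limI)
qed

lemma limit_defect_nonneg: "0 \<le> limit_defect t"
  by (rule LIMSEQ_le_const[OF limit_defect_tendsto]) (simp add: defect_nonneg)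

lemma limit_defect_le: "limit_defect t \<le> defect n (expo t)"
  using decseq_ge[OF decseq_defect limit_defect_tendsto] .

text \<open>The constant 1 is itself the frame function of the empty word and has norm 1, so its
  defect already vanishes at length 0.\<close>

lemma limit_defect_zero [simp]: "limit_defect 0 = 0"
proof -
  have "expo 0 = (\<lambda>x. 1)" by (simp add: fun_eq_iff)
  then have "L2_inner M (expo 0) (\<lambda>x. 1) = 1" using prob_space by (simp add: L2_inner_def)
  then have "defect 0 (expo 0) = 0" by (simp add: defect_def coeff_sq_def)
  then show ?thesis using limit_defect_le[of 0 0] limit_defect_nonneg[of 0] by simp
qed

lemma limit_defect_eq:
  "limit_defect t = (\<Sum>l\<in>L. step_prob l t * limit_defect ((t - of_int l) / of_int R))"
proof (rule LIMSEQ_unique)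
  show "(\<lambda>n. defect (Suc n) (expo t)) \<longlonglongrightarrow> limit_defect t"
    using limit_defect_tendsto by (rule LIMSEQ_Suc)
  show "(\<lambda>n. defect (Suc n) (expo t)) \<longlonglongrightarrow> (\<Sum>l\<in>L. step_prob l t * limit_defect ((t - of_int l) / of_int R))"
    unfolding defect_expo_Suc by (intro tendsto_sum tendsto_mult tendsto_const limit_defect_tendsto)
qed

text \<open>The coefficients of an exponential are values of the characteristic function of M up to
  constant factors.\<close>

lemma isCont_defect_expo: "isCont (\<lambda>t. defect n (expo t)) t"
proof -
  have "L2_inner M (expo s) (frame ws)
      = cnj (word_weight a ws) * char M (2 * pi * (s - of_int (word_freq R ws)))" for s ws
  proof -
    have "expo s x * cnj (frame ws x)
        = cnj (word_weight a ws) * iexp (2 * pi * (s - of_int (word_freq R ws)) * x)" for x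
    proof -
      have "expo s x * cnj (expo (of_int (word_freq R ws)) x) = cis (2 * pi * (s - of_int (word_freq R ws)) * x)"
        unfolding cnj_expo unfolding expo_eq_cis cis_mult
        by (rule arg_cong[of _ _ cis]) (simp add: algebra_simps)
      then show ?thesis by (simp add: frame_def cis_conv_exp mult_ac)
    qed
    then show ?thesis by (simp add: L2_inner_def char_def)
  qed
  then show ?thesis
    unfolding defect_def coeff_sq_def L2_sq_expo
    by (simp only:) (intro continuous_intros isCont_o2[OF _ isCont_char])
qed

text \<open>The limit defect is a decreasing limit of continuous functions, hence upper
  semicontinuous; stated as sequential closedness of superlevel sets.\<close>

lemma limit_defect_usc:
  assumes "s \<longlonglongrightarrow> t" "\<forall>\<^sub>F k in sequentially. m \<le> limit_defect (s k)"
  shows "m \<le> limit_defect t"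
proof (rule LIMSEQ_le_const[OF limit_defect_tendsto], intro exI allI impI)
  fix n
  have "(\<lambda>k. defect n (expo (s k))) \<longlonglongrightarrow> defect n (expo t)"
    using isCont_tendsto_compose[OF isCont_defect_expo assms(1)] .
  moreover have "\<forall>\<^sub>F k in sequentially. m \<le> defect n (expo (s k))"
    using assms(2) by eventually_elim (use limit_defect_le order_trans in blast)
  ultimately show "m \<le> defect n (expo t)"
    by (intro tendsto_lowerbound[of _ _ sequentially]) auto
qed

text \<open>A sequence approaching the supremum has a convergent subsequence, and upper
  semicontinuity suffices to bound the value at its limit from below.\<close>

lemma limit_defect_attains_max:
  assumes K: "compact K" "K \<noteq> {}"
  obtains t where "t \<in> K" "\<And>s. s \<in> K \<Longrightarrow> limit_defect s \<le> limit_defect t"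
proof -
  define S where "S = (SUP s\<in>K. limit_defect s)"
  have bdd: "bdd_above (limit_defect ` K)"
    by (rule bdd_aboveI[of _ 1]) (use limit_defect_le defect_le[of _ "expo _"] order_trans in \<open>fastforce\<close>)
  have "\<exists>s\<in>K. S - 1 / real (Suc k) < limit_defect s" for k
    unfolding S_def using K bdd by (subst less_cSUP_iff[symmetric]) auto
  then obtain s where s: "\<And>k. s k \<in> K" "\<And>k. S - 1 / real (Suc k) < limit_defect (s k)" by metis
  obtain t r where t: "t \<in> K" "strict_mono r" "(s \<circ> r) \<longlonglongrightarrow> t"
    using K(1) s(1) unfolding compact_def by metis
  have le: "S - e \<le> limit_defect t" if "e > 0" for e
  proof (rule limit_defect_usc[OF t(3)])
    have "(\<lambda>k. 1 / real (Suc k)) \<longlonglongrightarrow> 0" using LIMSEQ_inverse_real_of_nat by (simp add: inverse_eq_divide)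
    then have "\<forall>\<^sub>F k in sequentially. 1 / real (Suc k) < e" using \<open>e > 0\<close> by (rule order_tendstoD(2))
    then have "\<forall>\<^sub>F k in sequentially. 1 / real (Suc (r k)) < e"
      using filterlim_subseq[OF t(2)] by (rule eventually_compose_filterlim)
    then show "\<forall>\<^sub>F k in sequentially. S - e \<le> limit_defect ((s \<circ> r) k)"
    proof eventually_elim
      case (elim k)
      then show ?case using s(2)[of "r k"] by simp
    qed
  qed
  have "S \<le> limit_defect t" by (rule field_le_epsilon) (use le in \<open>simp add: diff_le_eq\<close>)
  moreover have "limit_defect s \<le> S" if "s \<in> K" for s
    unfolding S_def using that bdd by (rule cSUP_upper)
  ultimately show thesis using that[OF t(1)] order_trans by blast
qed

lemma limit_defect_eq_0:
  assumes "b \<noteq> 0" and a_nonzero: "\<forall>l\<in>L. a l \<noteq> 0"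
    and l1: "l1 \<in> L - {0}" and l2: "l2 \<in> L - {0}" and incong: "l1 mod R \<noteq> l2 mod R"
  shows "limit_defect t0 = 0"
proof (rule ccontr)
  assume "limit_defect t0 \<noteq> 0"
  \<comment> \<open>C bounds \<open>t0\<close> and all letters. Since R has modulus at least 2,
    \<open>(C + C) / 2 = C\<close> shows that the interval is mapped into itself by every
    step.\<close>
  define C where "C = max \<bar>t0\<bar> (Max ((\<lambda>l. \<bar>real_of_int l\<bar>) ` L))"
  define K where "K = {- C..C}"
  have t0: "t0 \<in> K" by (auto simp: K_def C_def)
  have L_le: "\<bar>real_of_int l\<bar> \<le> C" if "l \<in> L" for l
    using that finite_L by (auto simp: C_def intro!: max.coboundedI2)
  have R2: "\<bar>real_of_int R\<bar> \<ge> 2" using R_ge by linarith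
  have K_inv: "(t - of_int l) / of_int R \<in> K" if "t \<in> K" "l \<in> L" for t l
  proof -
    have "\<bar>t - of_int l\<bar> \<le> 2 * C" using that L_le[of l] by (auto simp: K_def)
    also have "\<dots> \<le> \<bar>real_of_int R\<bar> * C"
      using R2 t0 by (intro mult_right_mono) (auto simp: K_def)
    finally have "\<bar>(t - of_int l) / of_int R\<bar> \<le> C"
      using R2 by (simp add: abs_divide divide_le_eq mult.commute)
    then show ?thesis by (simp only: K_def atLeastAtMost_iff abs_le_iff minus_le_iff)
  qed
  obtain s where "s \<in> K" and s_max: "\<And>t. t \<in> K \<Longrightarrow> limit_defect t \<le> limit_defect s"
    using limit_defect_attains_max[of K] t0 by (auto simp: K_def)
  define m where "m = limit_defect s"
  have "m > 0"
    using s_max[OF t0] limit_defect_nonneg[of t0] \<open>limit_defect t0 \<noteq> 0\<close> by (simp add: m_def)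
  define X where "X = {t \<in> K. limit_defect t = m}"
  \<comment> \<open>The maximum m is an average of values at most m, so no value below m can carry
    positive weight.\<close>
  have X_step: "(t - of_int l) / of_int R \<in> X" if t: "t \<in> X" and l: "l \<in> L" and p: "step_prob l t \<noteq> 0" for t l
  proof (rule ccontr)
    assume not: "(t - of_int l) / of_int R \<notin> X"
    have le: "limit_defect ((t - of_int l) / of_int R) \<le> m" if "l \<in> L" for l
      using t s_max K_inv[OF _ that] by (simp add: X_def m_def)
    moreover have "limit_defect ((t - of_int l) / of_int R) \<noteq> m"
      using not K_inv[OF _ l] t by (simp add: X_def)
    ultimately have lt: "limit_defect ((t - of_int l) / of_int R) < m" using l by fastforce
    have "m = (\<Sum>l\<in>L. step_prob l t * limit_defect ((t - of_int l) / of_int R))"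
      using t limit_defect_eq[of t] by (simp add: X_def)
    also have "\<dots> < (\<Sum>l\<in>L. step_prob l t * m)"
    proof (rule sum_strict_mono_ex1[OF finite_L])
      show "\<forall>l\<in>L. step_prob l t * limit_defect ((t - of_int l) / of_int R) \<le> step_prob l t * m"
        using le by (auto intro!: mult_left_mono step_prob_nonneg)
      show "\<exists>l\<in>L. step_prob l t * limit_defect ((t - of_int l) / of_int R) < step_prob l t * m"
        using lt l p step_prob_nonneg[of l t] by (intro bexI[of _ l]) auto
    qed
    also have "\<dots> = m" by (simp add: sum_distrib_right[symmetric] sum_step_prob)
    finally show False by simp
  qed
  \<comment> \<open>The equation with odd \<open>j\<close> says that
    \<open>cos (pi * b * t1 / R)\<close> vanishes. If this never happened, the letter 0 would always
    have positive weight and all \<open>t / R ^ k\<close> would be maximisers tending to 0.\<close>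
  have X_cos_zero: "\<exists>k t1 j. t = of_int R ^ k * t1 \<and> t1 \<in> X \<and> odd j \<and> 2 * of_int b * t1 = of_int R * of_int j"
    if t: "t \<in> X" for t
  proof (rule ccontr)
    assume no: "\<not> ?thesis"
    have "t / of_int R ^ k \<in> X" for k
    proof (induction k)
      case 0
      show ?case using t by simp
    next
      case (Suc k)
      define t1 where "t1 = t / of_int R ^ k"
      have "cos (pi * of_int b * t1 / of_int R) \<noteq> 0"
      proof
        assume "cos (pi * of_int b * t1 / of_int R) = 0"
        then obtain j where "odd j" "pi * of_int b * t1 / of_int R = of_int j * (pi / 2)"
          by (auto simp: cos_zero_iff_int)
        then have "2 * of_int b * t1 = of_int R * of_int j" by (simp add: divide_simps) (simp add: mult_ac)
        moreover have "t = of_int R ^ k * t1" by (simp add: t1_def)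
        ultimately show False using no Suc \<open>odd j\<close> unfolding t1_def by blast
      qed
      then have "(t1 - of_int 0) / of_int R \<in> X"
        using Suc zero_L by (intro X_step) (auto simp: step_prob_zero t1_def)
      then show ?case by (simp add: t1_def mult.commute)
    qed
    then have "\<forall>\<^sub>F k in sequentially. m \<le> limit_defect (t / of_int R ^ k)"
      by (simp add: X_def)
    moreover have "(\<lambda>k. t / of_int R ^ k) \<longlonglongrightarrow> 0"
    proof -
      have "(\<lambda>k. t * (1 / of_int R) ^ k) \<longlonglongrightarrow> t * 0"
        using R2 by (intro tendsto_mult tendsto_const LIMSEQ_abs_realpow_zero2) (auto simp: abs_divide divide_less_eq)
      then show ?thesis by (simp add: power_one_over divide_inverse power_inverse)
    qed
    ultimately have "m \<le> limit_defect 0" by (intro limit_defect_usc)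
    then show False using \<open>m > 0\<close> by simp
  qed
  \<comment> \<open>Where the cosine vanishes the sine does not, so every nonzero letter has
    positive weight. Integrality holds because the difference of two odd numbers is even.\<close>
  have X_branch: "(t1 - of_int l) / of_int R \<in> X \<and> of_int b * ((t1 - of_int l) / of_int R) \<in> \<int>"
    if t1: "t1 \<in> X" "odd j" "2 * of_int b * t1 = of_int R * of_int j" and l: "l \<in> L - {0}" for t1 j l
  proof
    have "pi * of_int b * t1 / of_int R = of_int j * (pi / 2)"
      using t1(3) by (simp add: divide_simps) (simp add: mult_ac)
    then have "cos (pi * of_int b * t1 / of_int R) = 0" using t1(2) by (auto simp: cos_zero_iff_int)
    then have "sin (pi * of_int b * t1 / of_int R) \<noteq> 0" using sin_cos_squared_add[of "pi * of_int b * t1 / of_int R"] by auto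
    then show "(t1 - of_int l) / of_int R \<in> X"
      using t1 l a_nonzero by (intro X_step) (auto simp: step_prob_nonzero)
    obtain n where n: "odd n" "2 * l * b = R * n" using l half_odd unfolding half_odd_freqs_def by blast
    have "2 * real_of_int l * b = real_of_int R * n" using n(2) by (metis of_int_mult of_int_numeral)
    then have "of_int b * ((t1 - of_int l) / of_int R) = (of_int j - of_int n) / 2"
      using t1(3) by (simp add: field_simps)
    moreover have "even (j - n)" using t1(2) n(1) by simp
    then obtain i where "j - n = 2 * i" by (rule evenE)
    then have "j = n + 2 * i" by simp
    then have "(real_of_int j - real_of_int n) / 2 = of_int i" by simp
    ultimately show "of_int b * ((t1 - of_int l) / of_int R) \<in> \<int>" by simp
  qed
  \<comment> \<open>Each round goes to a zero of the cosine and then takes the letter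
    \<open>l1\<close>, dividing by R at least once. One round is needed even for
    \<open>n = 0\<close>, to make \<open>b * t'\<close> an integer.\<close>
  have X_descend: "\<exists>N k t'. N \<ge> n \<and> t = of_int R ^ N * t' + of_int k \<and> t' \<in> X \<and> of_int b * t' \<in> \<int>"
    if "t \<in> X" for t n
    using that
  proof (induction n arbitrary: t)
    case 0
    obtain k t1 j where t1: "t = of_int R ^ k * t1" "t1 \<in> X" "odd j" "2 * of_int b * t1 = of_int R * of_int j"
      using X_cos_zero[OF 0] by blast
    define t' where "t' = (t1 - of_int l1) / of_int R"
    have "t = of_int R ^ Suc k * t' + of_int (R ^ k * l1)"
      by (simp add: t1(1) t'_def field_simps)
    then show ?case using X_branch[OF t1(2-4) l1] unfolding t'_def[symmetric] by blast
  next
    case (Suc n)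
    obtain k t1 j where t1: "t = of_int R ^ k * t1" "t1 \<in> X" "odd j" "2 * of_int b * t1 = of_int R * of_int j"
      using X_cos_zero[OF Suc.prems] by blast
    define t2 where "t2 = (t1 - of_int l1) / of_int R"
    have t: "t = of_int R ^ Suc k * t2 + of_int (R ^ k * l1)"
      by (simp add: t1(1) t2_def field_simps)
    have "t2 \<in> X" using X_branch[OF t1(2-4) l1] by (simp add: t2_def)
    from Suc.IH[OF this] obtain N i t' where t': "N \<ge> n" "t2 = of_int R ^ N * t' + of_int i" "t' \<in> X" "of_int b * t' \<in> \<int>"
      by blast
    have "t = of_int R ^ (Suc k + N) * t' + of_int (R ^ Suc k * i + R ^ k * l1)"
      unfolding t t'(2) by (simp add: power_add algebra_simps)
    moreover have "Suc k + N \<ge> Suc n" using t'(1) by simp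
    ultimately show ?case using t'(3,4) by blast
  qed
  obtain c n where c: "coprime c R" "b dvd c * R ^ n" using coprime_part_dvd[OF \<open>b \<noteq> 0\<close>] by blast
  have c_int: "of_int c * t \<in> \<int>" if t: "t \<in> X" for t
  proof -
    obtain N k t' where t': "N \<ge> n" "t = of_int R ^ N * t' + of_int k" "of_int b * t' \<in> \<int>"
      using X_descend[OF t, of n] by blast
    \<comment> \<open>After enough steps the power of R absorbs the part of b not coprime to R, so
      multiplying by \<open>c\<close> alone makes t an integer.\<close>
    have "b dvd c * R ^ N" using c(2) t'(1) by (meson dvd_trans le_imp_power_dvd mult_dvd_mono dvd_refl)
    then obtain i where "c * R ^ N = b * i" by (auto elim: dvdE)
    then have "real_of_int c * of_int R ^ N = of_int b * of_int i" by (metis of_int_mult of_int_power)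
    then have "of_int c * t = of_int i * (of_int b * t') + of_int (c * k)"
      by (simp add: t'(2) algebra_simps)
    then show ?thesis using Ints_add[OF Ints_mult[OF Ints_of_int t'(3)] Ints_of_int] by simp
  qed
  have "s \<in> X" using \<open>s \<in> K\<close> by (simp add: X_def m_def)
  then obtain t1 j where t1: "t1 \<in> X" "odd j" "2 * of_int b * t1 = of_int R * of_int j"
    using X_cos_zero by blast
  have "of_int c * ((t1 - of_int l2) / of_int R) - of_int c * ((t1 - of_int l1) / of_int R) \<in> \<int>"
    using X_branch[OF t1 l1] X_branch[OF t1 l2] by (intro Ints_diff c_int) auto
  moreover have "of_int c * ((t1 - of_int l2) / of_int R) - of_int c * ((t1 - of_int l1) / of_int R)
      = of_int (c * (l1 - l2)) / real_of_int R"
    by (simp add: diff_divide_distrib algebra_simps)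
  ultimately obtain i where "of_int (c * (l1 - l2)) / real_of_int R = of_int i"
    by (auto elim: Ints_cases)
  then have "real_of_int (c * (l1 - l2)) = of_int (R * i)" by (simp add: divide_eq_eq mult.commute)
  then have "R dvd c * (l1 - l2)" by (metis dvd_triv_left of_int_eq_iff)
  then have "R dvd l1 - l2" using c(1) by (simp add: coprime_commute coprime_dvd_mult_right_iff)
  then show False using incong by (simp add: mod_eq_dvd_iff)
qed

end

section \<open>Density of trigonometric polynomials\<close>

inductive_set trig_poly :: "(real \<Rightarrow> complex) set" where
  trig_poly_expo: "(\<lambda>x. c * expo t x) \<in> trig_poly"
| trig_poly_add: "f \<in> trig_poly \<Longrightarrow> g \<in> trig_poly \<Longrightarrow> (\<lambda>x. f x + g x) \<in> trig_poly"

lemma trig_poly_const: "(\<lambda>x. c) \<in> trig_poly"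
  using trig_poly_expo[of c 0] by simp

lemma trig_poly_expo_mult:
  assumes "g \<in> trig_poly"
  shows "(\<lambda>x. c * expo t x * g x) \<in> trig_poly"
  using assms
proof induction
  case (trig_poly_expo d s)
  show ?case using trig_poly.trig_poly_expo[of "c * d" "t + s"] by (simp add: expo_add mult_ac)
next
  case (trig_poly_add f g)
  then show ?case by (simp add: distrib_left trig_poly.trig_poly_add)
qed

lemma trig_poly_mult:
  assumes "f \<in> trig_poly" "g \<in> trig_poly"
  shows "(\<lambda>x. f x * g x) \<in> trig_poly"
  using assms
proof induction
  case (trig_poly_expo c t)
  then show ?case by (rule trig_poly_expo_mult)
next
  case (trig_poly_add f h)
  then show ?case by (simp add: distrib_right trig_poly.trig_poly_add)
qed

lemma continuous_on_trig_poly: "f \<in> trig_poly \<Longrightarrow> continuous_on A f"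
  by (induction rule: trig_poly.induct) (auto intro!: continuous_intros)

text \<open>Real-valued trigonometric polynomials vanishing at x, used to separate points.\<close>

lemma trig_poly_sin: "(\<lambda>z. complex_of_real (sin (2 * pi * t * (z - x)))) \<in> trig_poly"
proof -
  have "complex_of_real (sin (2 * pi * t * (z - x)))
      = (expo (- t) x / (2 * \<i>)) * expo t z + (- expo t x / (2 * \<i>)) * expo (- t) z" for z
  proof -
    define y where "y = 2 * pi * t * (z - x)"
    have "complex_of_real (sin y) = cis y / (2 * \<i>) - cis (- y) / (2 * \<i>)"
      by (simp add: complex_eq_iff Re_divide Im_divide)
    moreover have "cis y = expo (- t) x * expo t z" "cis (- y) = expo t x * expo (- t) z"
      unfolding expo_eq_cis cis_mult y_def by (rule arg_cong[of _ _ cis], simp add: algebra_simps)+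
    ultimately show ?thesis by (simp add: y_def mult.assoc)
  qed
  then show ?thesis by (simp only:) (intro trig_poly.intros)
qed

lemma continuous_approx_trig_poly:
  fixes g :: "real \<Rightarrow> real"
  assumes "compact S" "continuous_on S g" "e > 0"
  obtains h where "(\<lambda>x. complex_of_real (h x)) \<in> trig_poly" "\<And>x. x \<in> S \<Longrightarrow> \<bar>g x - h x\<bar> < e"
proof -
  \<comment> \<open>Restricting to real functions whose complex versions are trigonometric
    polynomials permits the real Stone-Weierstrass theorem.\<close>
  interpret function_ring_on "{h. (\<lambda>x. complex_of_real (h x)) \<in> trig_poly}" S
  proof
    fix x y :: real
    assume "x \<noteq> y"
    \<comment> \<open>The distance from x to y becomes a quarter period, so the sine is 0 at x and 1
      at y.\<close>
    define t where "t = 1 / 4 / (y - x)"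
    have t: "t * (y - x) = 1 / 4" using \<open>x \<noteq> y\<close> unfolding t_def by (intro nonzero_eq_divide_eq[THEN iffD1]) auto
    have "2 * pi * t * (y - x) = pi / 2" unfolding mult.assoc t by simp
    then have "sin (2 * pi * t * (y - x)) = 1" by (simp only: sin_pi_half)
    then show "\<exists>f\<in>{h. (\<lambda>x. complex_of_real (h x)) \<in> trig_poly}. f x \<noteq> f y"
      by (intro bexI[of _ "\<lambda>z. sin (2 * pi * t * (z - x))"]) (auto intro: trig_poly_sin)
  next
    fix f assume "f \<in> {h. (\<lambda>x. complex_of_real (h x)) \<in> trig_poly}"
    then have "continuous_on S (\<lambda>x. Re (complex_of_real (f x)))"
      by (intro continuous_on_Re continuous_on_trig_poly) simp
    then show "continuous_on S f" by simp
  qed (use assms in \<open>auto intro: trig_poly_add trig_poly_mult trig_poly_const\<close>)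
  show thesis using Stone_Weierstrass_basic[OF assms(2,3)] that by blast
qed

section \<open>Bounded support of the measure\<close>

context self_similar_measure
begin

text \<open>Both branches map the larger interval into the smaller one, since
  \<open>(2 * c - \<bar>b\<bar>) + \<bar>b\<bar> = 2 * c\<close> and dividing by R at least halves
  it.\<close>

lemma prob_interval_ge:
  assumes "c \<ge> \<bar>of_int b\<bar>"
  shows "prob {- (2 * c - \<bar>of_int b\<bar>)..2 * c - \<bar>of_int b\<bar>} \<le> prob {- c..c}"
proof -
  let ?I = "{- (2 * c - \<bar>of_int b\<bar>)..2 * c - \<bar>of_int b\<bar>}"
  have R2: "\<bar>real_of_int R\<bar> \<ge> 2" using R_ge by linarith
  have sub: "?I \<subseteq> tau R d -` {- c..c}" if "\<bar>d\<bar> \<le> \<bar>b\<bar>" for d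
  proof
    fix x assume x: "x \<in> ?I"
    have "\<bar>real_of_int d\<bar> \<le> \<bar>real_of_int b\<bar>" using that by linarith
    then have "\<bar>x + of_int d\<bar> \<le> 2 * c" using x by auto
    also have "\<dots> \<le> \<bar>real_of_int R\<bar> * c" using R2 assms by (intro mult_right_mono) auto
    finally have "\<bar>tau R d x\<bar> \<le> c" using R2 by (simp add: tau_def abs_divide divide_le_eq mult.commute)
    then show "x \<in> tau R d -` {- c..c}" by auto
  qed
  have "prob ?I \<le> prob (tau R d -` {- c..c})" if "\<bar>d\<bar> \<le> \<bar>b\<bar>" for d
    by (rule finite_measure_mono[OF sub[OF that]]) simp
  from this[of 0] this[of b] show ?thesis
    using measure_self_similar[of "{- c..c}"] by simp
qed

text \<open>Iterating \<open>prob_interval_ge\<close> doubles the excess of the radius over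
  \<open>\<bar>b\<bar>\<close>, so no interval \<open>F n\<close> has more mass than
  \<open>F 0\<close>, while together they exhaust the line.\<close>

lemma AE_bounded: "AE x in M. x \<in> {- (\<bar>of_int b\<bar> + 1)..\<bar>of_int b\<bar> + 1}"
proof -
  define F where "F n = {- (\<bar>real_of_int b\<bar> + 2 ^ n)..\<bar>real_of_int b\<bar> + 2 ^ n}" for n :: nat
  have "prob (F n) \<le> prob (F 0)" for n
  proof (induction n)
    case (Suc n)
    have "prob (F (Suc n)) \<le> prob (F n)"
      using prob_interval_ge[of "\<bar>of_int b\<bar> + 2 ^ n"] by (simp add: F_def algebra_simps)
    with Suc show ?case by simp
  qed simp
  moreover have "(\<lambda>n. prob (F n)) \<longlonglongrightarrow> prob (\<Union>n. F n)"
  proof (rule finite_Lim_measure_incseq)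
    show "incseq F" unfolding incseq_def F_def
      by (auto intro: order_trans[OF _ add_left_mono[OF power_increasing]]
          order_trans[OF le_imp_neg_le[OF add_left_mono[OF power_increasing]]])
  qed (auto simp: F_def)
  moreover have "(\<Union>n. F n) = space M"
  proof -
    have "\<exists>n. x \<in> F n" for x
    proof -
      obtain n where "\<bar>x\<bar> < 2 ^ n" using real_arch_pow[of 2 "\<bar>x\<bar>"] by auto
      then show ?thesis by (intro exI[of _ n]) (auto simp: F_def)
    qed
    then show ?thesis by auto
  qed
  ultimately have "1 \<le> prob (F 0)"
    using prob_space by (intro LIMSEQ_le_const2[of "\<lambda>n. prob (F n)"]) auto
  then have "prob (F 0) = 1" by (simp add: antisym)
  then have "AE x in M. x \<in> F 0" by (subst prob_eq_1[symmetric]) (auto simp: F_def)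
  then show ?thesis by (simp add: F_def)
qed

end

section \<open>The closed subspace of functions whose defect tends to zero\<close>

context self_similar_frame
begin

definition no_defect :: "(real \<Rightarrow> complex) \<Rightarrow> bool" where
  "no_defect f \<longleftrightarrow> in_L2 M f \<and> (\<lambda>n. defect n f) \<longlonglongrightarrow> 0"

lemma no_defect_in_L2: "no_defect f \<Longrightarrow> in_L2 M f"
  by (simp add: no_defect_def)

lemma no_defect_add:
  assumes "no_defect f" "no_defect g"
  shows "no_defect (\<lambda>x. f x + g x)"
  unfolding no_defect_def
proof
  note L2 = no_defect_in_L2[OF assms(1)] no_defect_in_L2[OF assms(2)]
  show L2_add: "in_L2 M (\<lambda>x. f x + g x)" using L2 by (rule in_L2_add)
  have lim: "(\<lambda>n. 2 * defect n f + 2 * defect n g) \<longlonglongrightarrow> 2 * 0 + 2 * 0"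
    using assms unfolding no_defect_def by (intro tendsto_intros) auto
  show "(\<lambda>n. defect n (\<lambda>x. f x + g x)) \<longlonglongrightarrow> 0"
    by (rule tendsto_sandwich[OF _ _ tendsto_const])
      (use lim defect_add_le[OF L2] defect_nonneg[OF L2_add] in \<open>auto intro: always_eventually\<close>)
qed

lemma no_defect_cmult: "no_defect f \<Longrightarrow> no_defect (\<lambda>x. c * f x)"
  unfolding no_defect_def defect_cmult
  using tendsto_mult_right_zero[of "\<lambda>n. defect n f" sequentially "(cmod c)\<^sup>2"] by (simp add: in_L2_cmult)

lemma no_defect_sum:
  assumes "\<And>i. i \<in> I \<Longrightarrow> no_defect (f i)"
  shows "no_defect (\<lambda>x. \<Sum>i\<in>I. f i x)"
proof -
  have zero: "no_defect (\<lambda>x. 0)"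
    using defect_cmult[of _ 0] by (simp add: no_defect_def in_L2_def)
  show ?thesis using assms
    by (induction I rule: infinite_finite_induct) (auto simp: zero intro: no_defect_add)
qed

text \<open>The defect of f is at most twice that of g plus twice that of \<open>f - g\<close>, and
  the latter is bounded by the squared norm uniformly in n.\<close>

lemma no_defect_L2_closed:
  assumes f: "in_L2 M f" and ap: "\<And>e. e > 0 \<Longrightarrow> \<exists>g. no_defect g \<and> L2_sq (\<lambda>x. f x - g x) < e"
  shows "no_defect f"
  unfolding no_defect_def
proof (intro conjI f LIMSEQ_I)
  fix e :: real assume "e > 0"
  then obtain g where g: "no_defect g" "L2_sq (\<lambda>x. f x - g x) < e / 4" using ap[of "e / 4"] by auto
  note gL2 = no_defect_in_L2[OF g(1)]
  have "\<forall>\<^sub>F n in sequentially. defect n g < e / 4"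
    using g(1) \<open>e > 0\<close> unfolding no_defect_def by (intro order_tendstoD(2)) auto
  then obtain N where N: "\<And>n. n \<ge> N \<Longrightarrow> defect n g < e / 4" by (auto simp: eventually_sequentially)
  have "norm (defect n f - 0) < e" if "n \<ge> N" for n
  proof -
    have "defect n f \<le> 2 * defect n g + 2 * defect n (\<lambda>x. f x - g x)"
      using defect_add_le[OF gL2 in_L2_diff[OF f gL2], of n] by simp
    also have "\<dots> < e" using N[OF that] g(2) defect_le[of n "\<lambda>x. f x - g x"] by linarith
    finally show ?thesis using defect_nonneg[OF f] by simp
  qed
  then show "\<exists>N. \<forall>n\<ge>N. norm (defect n f - 0) < e" by blast
qed

text \<open>Dominated convergence turns pointwise limits into limits in the square norm. It carries
  all later passages to larger function classes except the one to continuous functions.\<close>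

lemma no_defect_dominated_limit:
  assumes F: "\<And>k. no_defect (F k)" and lim: "\<And>x. (\<lambda>k. F k x) \<longlonglongrightarrow> f x"
    and G: "integrable M (\<lambda>x. (G x)\<^sup>2)" and bound: "\<And>k x. cmod (F k x) \<le> G x"
  shows "no_defect f"
proof (rule no_defect_L2_closed)
  have [measurable]: "F k \<in> borel_measurable borel" for k
    using no_defect_in_L2[OF F] by (rule in_L2_measurable)
  have [measurable]: "f \<in> borel_measurable borel"
    using lim by (rule borel_measurable_LIMSEQ_metric[rotated]) measurable
  have f_le: "cmod (f x) \<le> G x" for x
    by (rule LIMSEQ_le_const2[OF tendsto_norm[OF lim]]) (use bound in blast)
  show "in_L2 M f"
    unfolding in_L2_def
  proof
    show "integrable M (\<lambda>x. (cmod (f x))\<^sup>2)"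
      by (rule Bochner_Integration.integrable_bound[OF G]) (auto intro!: power_mono f_le)
  qed measurable
  have "(\<lambda>k. L2_sq (\<lambda>x. f x - F k x)) \<longlonglongrightarrow> (LINT x|M. 0)"
    unfolding L2_sq_def
  proof (rule integral_dominated_convergence[where w = "\<lambda>x. 4 * (G x)\<^sup>2"])
    show "integrable M (\<lambda>x. 4 * (G x)\<^sup>2)" using G by simp
    show "AE x in M. (\<lambda>k. (cmod (f x - F k x))\<^sup>2) \<longlonglongrightarrow> 0"
    proof (rule AE_I2)
      fix x
      have "(\<lambda>k. (cmod (f x - F k x))\<^sup>2) \<longlonglongrightarrow> (cmod (f x - f x))\<^sup>2"
        by (intro tendsto_intros lim)
      then show "(\<lambda>k. (cmod (f x - F k x))\<^sup>2) \<longlonglongrightarrow> 0" by simp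
    qed
    show "AE x in M. norm ((cmod (f x - F k x))\<^sup>2) \<le> 4 * (G x)\<^sup>2" for k
    proof (rule AE_I2)
      fix x
      have "cmod (f x - F k x) \<le> 2 * G x"
        using norm_triangle_ineq4[of "f x" "F k x"] f_le[of x] bound[of k x] by linarith
      then have "(cmod (f x - F k x))\<^sup>2 \<le> (2 * G x)\<^sup>2" by (rule power_mono) simp
      then show "norm ((cmod (f x - F k x))\<^sup>2) \<le> 4 * (G x)\<^sup>2" by (simp add: power_mult_distrib)
    qed
  qed measurable
  then have L2_lim: "(\<lambda>k. L2_sq (\<lambda>x. f x - F k x)) \<longlonglongrightarrow> 0" by simp
  fix e :: real assume "e > 0"
  then have "\<forall>\<^sub>F k in sequentially. L2_sq (\<lambda>x. f x - F k x) < e"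
    using L2_lim by (intro order_tendstoD(2))
  then show "\<exists>g. no_defect g \<and> L2_sq (\<lambda>x. f x - g x) < e"
    using F by (auto simp: eventually_sequentially)
qed

lemma no_defect_trig_poly:
  assumes "\<And>t. no_defect (expo t)" "f \<in> trig_poly"
  shows "no_defect f"
  using assms(2) by induction (auto intro: no_defect_cmult no_defect_add assms(1))

text \<open>Uniform approximation is required only on the bounded interval that carries M; outside
  it the trigonometric polynomial may differ arbitrarily from g.\<close>

lemma no_defect_continuous:
  fixes g :: "real \<Rightarrow> real"
  assumes expo: "\<And>t. no_defect (expo t)" and cont: "continuous_on UNIV g" and bound: "\<And>x. \<bar>g x\<bar> \<le> B"
  shows "no_defect (\<lambda>x. complex_of_real (g x))"
proof (rule no_defect_L2_closed)
  have [measurable]: "g \<in> borel_measurable borel"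
    using cont by (rule borel_measurable_continuous_onI)
  show gL2: "in_L2 M (\<lambda>x. complex_of_real (g x))"
    by (rule in_L2_bounded[where K = B]) (use bound in auto)
  fix e :: real assume "e > 0"
  define S where "S = {- (\<bar>real_of_int b\<bar> + 1)..\<bar>real_of_int b\<bar> + 1}"
  have "compact S" by (simp add: S_def)
  moreover have "continuous_on S g" using cont continuous_on_subset by blast
  moreover have "sqrt (e / 2) > 0" using \<open>e > 0\<close> by simp
  ultimately obtain h where h: "(\<lambda>x. complex_of_real (h x)) \<in> trig_poly" "\<And>x. x \<in> S \<Longrightarrow> \<bar>g x - h x\<bar> < sqrt (e / 2)"
    using continuous_approx_trig_poly[of S g "sqrt (e / 2)"] by blast
  have t: "no_defect (\<lambda>x. complex_of_real (h x))" using no_defect_trig_poly[OF expo h(1)] .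
  have "L2_sq (\<lambda>x. complex_of_real (g x) - complex_of_real (h x)) \<le> (LINT x|M. e / 2)"
    unfolding L2_sq_def
  proof (rule integral_mono_AE)
    show "integrable M (\<lambda>x. (cmod (complex_of_real (g x) - complex_of_real (h x)))\<^sup>2)"
      using in_L2_diff[OF gL2 no_defect_in_L2[OF t]] by (simp add: in_L2_def)
    show "AE x in M. (cmod (complex_of_real (g x) - complex_of_real (h x)))\<^sup>2 \<le> e / 2"
      using AE_bounded
    proof eventually_elim
      case (elim x)
      then have "\<bar>g x - h x\<bar> < sqrt (e / 2)" by (intro h(2)) (simp add: S_def)
      then have "\<bar>g x - h x\<bar>\<^sup>2 \<le> (sqrt (e / 2))\<^sup>2" by (intro power_mono) auto
      then show ?case using \<open>e > 0\<close> by (simp flip: of_real_diff)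
    qed
  qed simp
  also have "\<dots> < e" using \<open>e > 0\<close> prob_space by simp
  finally show "\<exists>g'. no_defect g' \<and> L2_sq (\<lambda>x. complex_of_real (g x) - g' x) < e" using t by blast
qed

lemma no_defect_indicator_atMost:
  assumes expo: "\<And>t. no_defect (expo t)"
  shows "no_defect (indicator {..c})"
proof (rule no_defect_dominated_limit[where G = "\<lambda>x. 1"])
  \<comment> \<open>Continuous ramps, equal to 1 up to c and falling to 0 at
    \<open>c + 1 / k\<close> for positive k.\<close>
  define g where "g k x = max 0 (min 1 (1 - real k * (x - c)))" for k x
  show "no_defect (\<lambda>x. complex_of_real (g k x))" for k
    unfolding g_def by (rule no_defect_continuous[OF expo, where B = 1]) (auto intro!: continuous_intros)
  show "cmod (complex_of_real (g k x)) \<le> 1" for k x by (simp add: g_def)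
  show "(\<lambda>k. complex_of_real (g k x)) \<longlonglongrightarrow> indicator {..c} x" for x
  proof (cases "x \<le> c")
    case True
    then have "g k x = 1" for k by (simp add: g_def mult_nonneg_nonpos)
    with True show ?thesis by simp
  next
    case False
    obtain N where N: "1 < real N * (x - c)" using False reals_Archimedean3[of "x - c"] by auto
    have "g k x = 0" if "k \<ge> N" for k
    proof -
      have "real N * (x - c) \<le> real k * (x - c)" using False that by (intro mult_right_mono) auto
      with N show ?thesis by (simp add: g_def)
    qed
    then have "\<forall>\<^sub>F k in sequentially. complex_of_real (g k x) = 0"
      by (auto simp: eventually_sequentially)
    with False show ?thesis by (simp add: tendsto_eventually)
  qed
qed simp

text \<open>Half-lines form an intersection-stable generator of the Borel sets. Complements are
  handled by linearity, disjoint unions by finite sums and a limit dominated by 1.\<close>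

lemma no_defect_indicator:
  assumes expo: "\<And>t. no_defect (expo t)" and A: "A \<in> sets borel"
  shows "no_defect (indicator A)"
proof -
  let ?G = "range (\<lambda>c::real. {..c})"
  have "Int_stable ?G" by (auto simp: Int_stable_def)
  moreover have "?G \<subseteq> Pow UNIV" by simp
  moreover have "A \<in> sigma_sets UNIV ?G" using A by (simp add: borel_eq_atMost)
  ultimately show ?thesis
  proof (induction rule: sigma_sets_induct_disjoint)
    case (basic A)
    then show ?case using no_defect_indicator_atMost[OF expo] by auto
  next
    case empty
    then show ?case using no_defect_sum[of "{}"] by simp
  next
    case (compl A)
    have "(indicator (UNIV - A) :: real \<Rightarrow> complex) = (\<lambda>x. expo 0 x + (-1) * indicator A x)"
      by (auto simp: fun_eq_iff indicator_def)
    then show ?case using compl expo by (simp only:) (intro no_defect_add no_defect_cmult)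
  next
    case (union A)
    show ?case
    proof (rule no_defect_dominated_limit[where G = "\<lambda>x. 1"])
      fix k
      have "disjoint_family_on A {..<k}" using union(1) by (rule disjoint_family_on_mono[rotated]) simp
      then have "(indicator (\<Union>i<k. A i) :: real \<Rightarrow> complex) = (\<lambda>x. \<Sum>i<k. indicator (A i) x)"
        by (simp add: fun_eq_iff indicator_UN_disjoint)
      then show "no_defect (indicator (\<Union>i<k. A i))" using union by (simp add: no_defect_sum)
      show "cmod (indicator (\<Union>i<k. A i) x) \<le> 1" for x by (simp add: indicator_def)
    next
      show "(\<lambda>k. indicator (\<Union>i<k. A i) x :: complex) \<longlonglongrightarrow> indicator (\<Union>i. A i) x" for x
        by (rule LIMSEQ_indicator_UN)
    qed simp
  qed
qed

text \<open>Simple functions approximate f pointwise and are bounded by twice its modulus, which is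
  square-integrable.\<close>

lemma no_defect_L2:
  assumes expo: "\<And>t. no_defect (expo t)" and f: "in_L2 M f"
  shows "no_defect f"
proof -
  have "f \<in> borel_measurable M" using f by (simp add: in_L2_def)
  from borel_measurable_implies_sequence_metric[OF this, of 0] obtain F where
    F: "\<And>i. simple_function M (F i)" "\<And>x. (\<lambda>i. F i x) \<longlonglongrightarrow> f x" "\<And>i x. cmod (F i x) \<le> 2 * cmod (f x)"
    by auto
  show ?thesis
  proof (rule no_defect_dominated_limit[OF _ F(2), where G = "\<lambda>x. 2 * cmod (f x)"])
    show "integrable M (\<lambda>x. (2 * cmod (f x))\<^sup>2)"
      using f by (simp add: in_L2_def power_mult_distrib)
    fix k
    have "F k = (\<lambda>x. \<Sum>y\<in>range (F k). y * indicator (F k -` {y}) x)"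
    proof
      fix x
      have "F k x = (\<Sum>y\<in>F k ` space M. indicator (F k -` {y} \<inter> space M) x *\<^sub>R y)"
        by (rule simple_function_indicator_representation_banach[OF F(1)]) simp
      also have "\<dots> = (\<Sum>y\<in>range (F k). y * indicator (F k -` {y}) x)"
        by (intro sum.cong) (auto simp: indicator_def)
      finally show "F k x = (\<Sum>y\<in>range (F k). y * indicator (F k -` {y}) x)" .
    qed
    moreover have "F k -` {y} \<in> sets borel" for y
      using simple_functionD(2)[OF F(1), of k "{y}"] by simp
    then have "no_defect (\<lambda>x. \<Sum>y\<in>range (F k). y * indicator (F k -` {y}) x)"
      by (intro no_defect_sum no_defect_cmult no_defect_indicator expo)
    ultimately show "no_defect (F k)" by simp
  qed (use F in auto)
qed

lemma parseval_frame_frame: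
  assumes "b \<noteq> 0" "\<forall>l\<in>L. a l \<noteq> 0" "l1 \<in> L - {0}" "l2 \<in> L - {0}" "l1 mod R \<noteq> l2 mod R"
  shows "parseval_frame M (Omega L) frame"
  unfolding parseval_frame_def
proof (intro allI impI)
  fix f assume f: "in_L2 M f"
  have "no_defect (expo t)" for t
    using limit_defect_tendsto[of t] limit_defect_eq_0[OF assms, of t] by (simp add: no_defect_def)
  then have "no_defect f" using f by (rule no_defect_L2)
  then show "((\<lambda>ws. (cmod (L2_inner M f (frame ws)))\<^sup>2) has_sum (LINT x|M. (cmod (f x))\<^sup>2)) (Omega L)"
    using has_sum_if_defect_tendsto_0[OF f] by (simp add: no_defect_def L2_sq_def)
qed

end

theorem theorem5p6:
  fixes R b :: int and L :: "int set" and a :: "int \<Rightarrow> complex" and M :: "real measure"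
  assumes "\<bar>R\<bar> \<ge> 2" and "b \<noteq> 0"
    and "finite L" and "0 \<in> L"
    and "\<forall>l\<in>L. a l \<noteq> 0" and "a 0 = 1"
    and "is_mu R b M"
  shows "(ortho_columns R {0, b} L a \<longleftrightarrow> conds_i_iv R b L a)
       \<and> (conds_i_iv R b L a \<and>
           (\<exists>l1\<in>L - {0}. \<exists>l2\<in>L - {0}. l1 mod R \<noteq> l2 mod R)
          \<longrightarrow> parseval_frame M (Omega L)
                (\<lambda>ws x. word_weight a ws * expo (real_of_int (word_freq R ws)) x))"
proof (intro conjI impI)
  have R: "R \<noteq> 0" using assms(1) by auto
  show "ortho_columns R {0, b} L a \<longleftrightarrow> conds_i_iv R b L a"
    using ortho_columns_iff_half_odd[OF R assms(2-6)] conds_i_iv_iff[OF R assms(2)] by simp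
  assume hyp: "conds_i_iv R b L a \<and> (\<exists>l1\<in>L - {0}. \<exists>l2\<in>L - {0}. l1 mod R \<noteq> l2 mod R)"
  have mu: "sets M = sets borel" "prob_space M"
    "\<And>E. E \<in> sets borel \<Longrightarrow> measure M E = (measure M (tau R 0 -` E) + measure M (tau R b -` E)) / 2"
    using assms(7) unfolding is_mu_def by auto
  interpret prob_space M by (rule mu(2))
  interpret self_similar_frame M R b L a
    using hyp conds_i_iv_iff[OF R assms(2)] assms mu by unfold_locales auto
  show "parseval_frame M (Omega L) (\<lambda>ws x. word_weight a ws * expo (real_of_int (word_freq R ws)) x)"
    using parseval_frame_frame[OF assms(2,5)] hyp unfolding frame_def[abs_def] by blast
qed

end
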